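(* Let $\Gamma:[0,1]^2\to\mathbb R$ be a continuous covariance kernel with eigenvalues $\lambda_1\ge\lambda_2\ge\dots\ge0$ and an orthonormal basis $(\phi_j)_{j\ge 1}$ of $L_2[0,1]$ of associated eigenfunctions of its integral operator $T_\Gamma$. Let $(\hat\Gamma_n)_{n\ge 1}$ be a sequence of random continuous symmetric kernels on $[0,1]^2$ (not necessarily positive semidefinite) such that $$\sqrt n\,(\hat\Gamma_n-\Gamma)\ \stackrel{D}{\longrightarrow}\ \mathcal G\qquad\text{in } C([0,1]^2),$$ where $\mathcal G$ is a tight random variable in $C([0,1]^2)$. For given $k$, suppose that $\lambda_k>0$ is a simple eigenvalue of $T_\Gamma$, so that the spectral gap $\delta_k$ is positive. Let $\hat\phi_{k;n}$ be a normalized eigenfunction of $T_{\hat\Gamma_n}$ for its $k$-th largest eigenvalue $\hat\lambda_{k;n}$, and assume that $\phi_k$, $\hat\phi_{k;n}$ are chosen such that $\langle\hat\phi_{k;n},\phi_k\rangle\ge0$. Then $$\sqrt n\,(\hat\phi_{k;n}-\phi_k)\ \stackrel{D}{\longrightarrow}\ \sum_{j\ne k}\frac{\langle T_{\mathcal G}\phi_k,\phi_j\rangle}{\lambda_k-\lambda_j}\,\phi_j\qquad\text{in } C[0,1],$$ where $T_{\mathcal G}$ is the random integral operator associated with the kernel $\mathcal G$.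
   Context: A covariance kernel is a symmetric positive semidefinite kernel. For a continuous kernel $G$ on $[0,1]^2$, $(T_Gf)(x)=\int_0^1G(x,y)f(y)\,dy$ for $f\in L_2[0,1]$. Eigenvalues are ordered decreasingly and repeated by multiplicity; eigenfunctions have $L_2[0,1]$-norm one, and those for non-zero eigenvalues are identified with their continuous versions. The basis $(\phi_j)$ includes eigenfunctions for the eigenvalue $0$, if any. $\langle\cdot,\cdot\rangle$ is the $L_2[0,1]$ inner product. The spectral gap is $\delta_k=\min(\lambda_{k-1}-\lambda_k,\lambda_k-\lambda_{k+1})$ for $k\ge 2$, $\delta_1=\lambda_1-\lambda_2$. $C([0,1]^2)$ and $C[0,1]$ carry the supremum norm, and $\stackrel{D}{\to}$ denotes weak convergence (convergence in distribution). On the event (of probability tending to zero) that $T_{\hat\Gamma_n}$ has fewer than $k$ positive eigenvalues counted with multiplicity, $\hat\phi_{k;n}$ is any element of $C[0,1]$. The limit series is understood as a limit in $L_2[0,1]$, identified with its continuous version. *)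

theory Defs
  imports "HOL-Probability.Probability"
begin

section \<open>The unit interval as a type\<close>

text \<open>With \<open>[0,1]\<close> as a compact metric space type, \<open>C[0,1]\<close> and \<open>C([0,1]\<^sup>2)\<close> with the
  supremum norm are the types \<open>unit_ivl \<Rightarrow>\<^sub>C real\<close> and \<open>unit_ivl \<times> unit_ivl \<Rightarrow>\<^sub>C real\<close>;
  boundedness is no restriction, see \<open>bcontfun_unit_ivl\<close> and \<open>bcontfun_unit_square\<close>.\<close>

typedef unit_ivl = "{0..1::real}"
  by (rule exI[of _ 0]) simp

instantiation unit_ivl :: metric_space
begin

definition dist_unit_ivl :: "unit_ivl \<Rightarrow> unit_ivl \<Rightarrow> real" where
  "dist x y = dist (Rep_unit_ivl x) (Rep_unit_ivl y)"

definition uniformity_unit_ivl :: "(unit_ivl \<times> unit_ivl) filter" where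
  "uniformity_unit_ivl = (INF e\<in>{0<..}. principal {(x, y). dist x y < e})"

definition open_unit_ivl :: "unit_ivl set \<Rightarrow> bool" where
  "open_unit_ivl S = (\<forall>x\<in>S. \<forall>\<^sub>F (x', y) in uniformity. x' = x \<longrightarrow> y \<in> S)"

instance
proof
  fix x y z :: unit_ivl
  show "dist x y = 0 \<longleftrightarrow> x = y"
    by (simp add: dist_unit_ivl_def Rep_unit_ivl_inject)
  show "dist x y \<le> dist x z + dist y z"
    unfolding dist_unit_ivl_def by (rule dist_triangle2)
qed (simp_all add: uniformity_unit_ivl_def open_unit_ivl_def)

end

lemma continuous_on_Abs_unit_ivl: "continuous_on {0..1} Abs_unit_ivl"
  unfolding continuous_on_iff dist_unit_ivl_def by (auto simp: Abs_unit_ivl_inverse)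

lemma compact_UNIV_unit_ivl: "compact (UNIV :: unit_ivl set)"
proof -
  have "range Rep_unit_ivl = {0..1}"
    by (rule type_definition.Rep_range[OF type_definition_unit_ivl])
  then have "(UNIV :: unit_ivl set) = Abs_unit_ivl ` {0..1}"
    by (metis (no_types, lifting) Rep_unit_ivl_inverse UNIV_eq_I image_eqI rangeI)
  then show ?thesis
    using compact_continuous_image[OF continuous_on_Abs_unit_ivl] by simp
qed

lemma bcontfun_compact:
  fixes f :: "'a::topological_space \<Rightarrow> real"
  assumes "compact (UNIV :: 'a set)"
  shows "f \<in> bcontfun \<longleftrightarrow> continuous_on UNIV f"
  using assms compact_continuous_image[of UNIV f] by (auto simp: bcontfun_def compact_imp_bounded)

lemma bcontfun_unit_ivl:
  "(f :: unit_ivl \<Rightarrow> real) \<in> bcontfun \<longleftrightarrow> continuous_on UNIV f"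
  by (rule bcontfun_compact[OF compact_UNIV_unit_ivl])

lemma bcontfun_unit_square:
  "(f :: unit_ivl \<times> unit_ivl \<Rightarrow> real) \<in> bcontfun \<longleftrightarrow> continuous_on UNIV f"
  using compact_Times[OF compact_UNIV_unit_ivl compact_UNIV_unit_ivl]
  by (intro bcontfun_compact) simp


section \<open>The space \<open>L\<^sub>2[0,1]\<close>\<close>

definition leb01 :: "unit_ivl measure" where
  "leb01 = distr (restrict_space lborel {0..1}) borel Abs_unit_ivl"

lemma sets_leb01 [simp]: "sets leb01 = sets borel"
  by (simp add: leb01_def)

lemma measurable_Abs_unit_ivl:
  "Abs_unit_ivl \<in> borel_measurable (restrict_space lborel {0..1})"
proof -
  have "sets (restrict_space lborel {0..1}) = sets (restrict_space (borel :: real measure) {0..1})"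
    by (rule sets_restrict_space_cong) simp
  then show ?thesis
    using borel_measurable_continuous_on_restrict[OF continuous_on_Abs_unit_ivl]
    by (simp cong: measurable_cong_sets)
qed

lemma integral_leb01:
  fixes f :: "unit_ivl \<Rightarrow> real"
  assumes "f \<in> borel_measurable borel"
  shows "(\<integral>x. f x \<partial>leb01) = (LINT x:{0..1}|lborel. f (Abs_unit_ivl x))"
  using assms
  by (simp add: leb01_def integral_distr[OF measurable_Abs_unit_ivl] integral_restrict_space
      set_lebesgue_integral_def)

lemma prob_space_leb01: "prob_space leb01"
  unfolding leb01_def
proof (rule prob_space.prob_space_distr[OF _ measurable_Abs_unit_ivl])
  show "prob_space (restrict_space lborel {0..1::real})"
    by (rule prob_spaceI) (simp add: space_restrict_space emeasure_restrict_space)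
qed

text \<open>Elements of \<open>L\<^sub>2[0,1]\<close> are represented by functions; equality in \<open>L\<^sub>2\<close> is equality
  almost everywhere.\<close>

definition L2 :: "(unit_ivl \<Rightarrow> real) set" where
  "L2 = {f \<in> borel_measurable leb01. integrable leb01 (\<lambda>x. (f x)\<^sup>2)}"

definition L2_inner :: "(unit_ivl \<Rightarrow> real) \<Rightarrow> (unit_ivl \<Rightarrow> real) \<Rightarrow> real" where
  "L2_inner f g = (\<integral>x. f x * g x \<partial>leb01)"

definition L2_norm :: "(unit_ivl \<Rightarrow> real) \<Rightarrow> real" where
  "L2_norm f = sqrt (L2_inner f f)"

definition has_L2_sum :: "('i \<Rightarrow> unit_ivl \<Rightarrow> real) \<Rightarrow> 'i set \<Rightarrow> (unit_ivl \<Rightarrow> real) \<Rightarrow> bool" where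
  "has_L2_sum g A s \<longleftrightarrow> s \<in> L2 \<and> (\<forall>j\<in>A. g j \<in> L2) \<and>
     ((\<lambda>F. L2_norm (\<lambda>x. s x - (\<Sum>j\<in>F. g j x))) \<longlongrightarrow> 0) (finite_subsets_at_top A)"

definition orthonormal_basis :: "'i set \<Rightarrow> ('i \<Rightarrow> unit_ivl \<Rightarrow> real) \<Rightarrow> bool" where
  "orthonormal_basis J \<phi> \<longleftrightarrow>
     (\<forall>j\<in>J. \<phi> j \<in> L2) \<and>
     (\<forall>i\<in>J. \<forall>j\<in>J. L2_inner (\<phi> i) (\<phi> j) = (if i = j then 1 else 0)) \<and>
     (\<forall>f\<in>L2. has_L2_sum (\<lambda>j x. L2_inner f (\<phi> j) * \<phi> j x) J f)"


section \<open>Kernels, integral operators and their eigenvalues\<close>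

type_synonym kernel = "(unit_ivl \<times> unit_ivl) \<Rightarrow>\<^sub>C real"

definition symmetric_kernel :: "kernel \<Rightarrow> bool" where
  "symmetric_kernel G \<longleftrightarrow> (\<forall>x y. apply_bcontfun G (x, y) = apply_bcontfun G (y, x))"

definition covariance_kernel :: "kernel \<Rightarrow> bool" where
  "covariance_kernel G \<longleftrightarrow> symmetric_kernel G \<and>
     (\<forall>S c. finite S \<longrightarrow> (\<Sum>x\<in>S. \<Sum>y\<in>S. c x * c y * apply_bcontfun G (x, y)) \<ge> 0)"

definition int_op :: "kernel \<Rightarrow> (unit_ivl \<Rightarrow> real) \<Rightarrow> unit_ivl \<Rightarrow> real" where
  "int_op G f x = (\<integral>y. apply_bcontfun G (x, y) * f y \<partial>leb01)"

text \<open>The eigenspace is only used for \<open>\<mu> > 0\<close>. There each eigenfunction in \<open>L\<^sub>2[0,1]\<close> has a unique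
  continuous version, and the eigenspace has finite dimension (\<open>dim\<close> is \<open>0\<close> on
  infinite-dimensional spaces).\<close>

definition eigenspace :: "kernel \<Rightarrow> real \<Rightarrow> (unit_ivl \<Rightarrow>\<^sub>C real) set" where
  "eigenspace G \<mu> =
     {f. \<forall>x. int_op G (apply_bcontfun f) x = \<mu> * apply_bcontfun f x}"

definition is_eigenvalue :: "kernel \<Rightarrow> real \<Rightarrow> bool" where
  "is_eigenvalue G \<mu> \<longleftrightarrow> (\<exists>f\<in>eigenspace G \<mu>. f \<noteq> 0)"

definition multiplicity_of :: "kernel \<Rightarrow> real \<Rightarrow> nat" where
  "multiplicity_of G \<mu> = dim (eigenspace G \<mu>)"

text \<open>The number of eigenvalues in \<open>[t, \<infinity>)\<close>, repeated by multiplicity. For symmetric kernels and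
  \<open>t > 0\<close> the sum ranges over a finite set, because the integral operator is compact.\<close>

definition eigenvalue_count :: "kernel \<Rightarrow> real \<Rightarrow> nat" where
  "eigenvalue_count G t = (\<Sum>\<mu> | t \<le> \<mu> \<and> is_eigenvalue G \<mu>. multiplicity_of G \<mu>)"

text \<open>The \<open>k\<close>-th largest eigenvalue, for \<open>k \<ge> 1\<close>, if there are at least \<open>k\<close> positive eigenvalues
  repeated by multiplicity, and \<open>0\<close> otherwise. For covariance kernels this is the
  sequence \<open>\<lambda>\<^sub>1 \<ge> \<lambda>\<^sub>2 \<ge> \<dots> \<ge> 0\<close>. The supremum is attained.\<close>

definition kth_eigenvalue :: "kernel \<Rightarrow> nat \<Rightarrow> real" where
  "kth_eigenvalue G k =
     Sup (insert 0 {\<mu>. 0 < \<mu> \<and> is_eigenvalue G \<mu> \<and> k \<le> eigenvalue_count G \<mu>})"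

text \<open>If there are infinitely many positive eigenvalues, they use up all the indices \<open>j \<ge> 1\<close> of the
  decreasing sequence, although \<open>0\<close> may still be an eigenvalue. A complete basis may
  therefore need further eigenfunctions for the eigenvalue \<open>0\<close>. These carry indices \<open>j \<le> 0\<close>;
  for \<open>J = {1..}\<close> there are none.\<close>

definition eigenbasis :: "kernel \<Rightarrow> int set \<Rightarrow> (int \<Rightarrow> real) \<Rightarrow> (int \<Rightarrow> unit_ivl \<Rightarrow> real) \<Rightarrow> bool" where
  "eigenbasis G J lam \<phi> \<longleftrightarrow>
     {1..} \<subseteq> J \<and> orthonormal_basis J \<phi> \<and>
     (\<forall>j\<in>J. lam j = (if j \<ge> 1 then kth_eigenvalue G (nat j) else 0)) \<and>
     (\<forall>j\<in>J. AE x in leb01. int_op G (\<phi> j) x = lam j * \<phi> j x) \<and>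
     (\<forall>j\<in>J. lam j \<noteq> 0 \<longrightarrow> continuous_on UNIV (\<phi> j))"


section \<open>Convergence in distribution\<close>

definition converges_in_distribution ::
  "(nat \<Rightarrow> 'w measure) \<Rightarrow> (nat \<Rightarrow> 'w \<Rightarrow> 'a::metric_space) \<Rightarrow> 'v measure \<Rightarrow> ('v \<Rightarrow> 'a) \<Rightarrow> bool"
where
  "converges_in_distribution M X N Y \<longleftrightarrow>
     (\<forall>n. X n \<in> borel_measurable (M n)) \<and> Y \<in> borel_measurable N \<and>
     (\<forall>f :: 'a \<Rightarrow> real. continuous_on UNIV f \<and> bounded (range f) \<longrightarrow>
        (\<lambda>n. \<integral>\<omega>. f (X n \<omega>) \<partial>M n) \<longlonglongrightarrow> (\<integral>\<omega>. f (Y \<omega>) \<partial>N))"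

definition tight_random_element :: "'v measure \<Rightarrow> ('v \<Rightarrow> 'a::metric_space) \<Rightarrow> bool" where
  "tight_random_element N Y \<longleftrightarrow> Y \<in> borel_measurable N \<and>
     (\<forall>\<epsilon>>0. \<exists>K. compact K \<and> measure N {\<omega> \<in> space N. Y \<omega> \<in> K} \<ge> 1 - \<epsilon>)"

end

theory Submission
  imports Defs "HOL-Complex_Analysis.Great_Picard"
begin

text \<open>Write \<open>\<Delta>\<close> for the difference of a symmetric kernel \<open>G\<close> and \<open>\<Gamma>\<close>, and let \<open>f\<close> be a normalized
  eigenfunction of \<open>T\<^sub>G\<close> for its \<open>k\<close>-th eigenvalue \<open>\<mu>\<close>. By the min-max principle
  \<open>\<bar>\<mu> - \<lambda>\<^sub>k\<bar> \<le> \<parallel>\<Delta>\<parallel>\<close>. The reduced resolvent \<open>S\<close> of \<open>T\<^sub>\<Gamma>\<close> at \<open>\<lambda>\<^sub>k\<close> is a bounded operator on \<open>C[0,1]\<close>, and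
  applying it to \<open>(\<lambda>\<^sub>k - T\<^sub>\<Gamma>) f = (\<lambda>\<^sub>k - \<mu>) f + T\<^sub>\<Delta> f\<close> first gives \<open>f - \<phi>\<^sub>k = O(\<parallel>\<Delta>\<parallel>)\<close> and then
  \<open>f - \<phi>\<^sub>k = S T\<^sub>\<Delta> \<phi>\<^sub>k + O(\<parallel>\<Delta>\<parallel>\<^sup>2)\<close> in the supremum norm. Hence \<open>\<surd>n (f\<^sub>n - \<phi>\<^sub>k)\<close> is a continuous linear
  function of \<open>\<surd>n \<Delta>\<^sub>n\<close> up to an error that vanishes uniformly on bounded sets of \<open>\<surd>n \<Delta>\<^sub>n\<close>, and
  tightness of the limit lets one restrict to such sets.\<close>

text \<open>Why the error is quadratic: \<open>(\<lambda>\<^sub>k - \<mu>) f\<close> alone is only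
  of first order in \<Delta>, but \<open>S\<close> annihilates \<open>\<phi>\<^sub>k\<close>, so
  \<open>S\<close> sees just \<open>f - \<phi>\<^sub>k\<close> in it and the product is of second
  order. The component of \<open>f\<close> along \<open>\<phi>\<^sub>k\<close> is invisible to
  \<open>S\<close>; normalization and sign convention force it to within a constant times
  \<open>\<parallel>\<Delta>\<parallel>\<^sup>2\<close> of 1. Supremum norm bounds come from
  \<open>L\<^sub>2\<close> bounds through one property: an integral operator with continuous kernel
  is bounded from \<open>L\<^sub>2[0,1]\<close> to \<open>C[0,1]\<close>. It replaces bounds on the
  single \<open>\<phi>\<^sub>j\<close>, which need not be uniform in \<open>j\<close> and, for the
  eigenvalue 0, not even exist. The perturbed kernel may be indefinite, and its \<open>k\<close>-th
  eigenvalue is given by counting multiplicities. The min-max principle is therefore proved for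
  these counts directly, from finite orthonormal systems of eigenfunctions and deflation. The error
  estimate is deterministic, so the probabilistic part needs no joint measurability, and the event
  of too few positive eigenvalues is excluded as soon as
  \<open>\<parallel>\<Delta>\<parallel> < \<lambda>\<^sub>k / 2\<close>.\<close>

section \<open>Topology and Lebesgue measure of the unit interval\<close>

instance unit_ivl :: second_countable_topology
proof
  obtain B :: "real set set" where B: "countable B" "topological_basis B"
    using ex_countable_basis by blast
  have cont: "continuous_on UNIV Rep_unit_ivl"
    unfolding continuous_on_iff by (auto simp: dist_unit_ivl_def)
  let ?B = "(\<lambda>b. Rep_unit_ivl -` b) ` B"
  have "topological_basis ?B"
  proof (rule topological_basisI)
    fix b' assume "b' \<in> ?B"
    then show "open b'"
      using B(2) open_vimage[OF _ cont] by (auto dest: topological_basis_open)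
  next
    fix U :: "unit_ivl set" and x
    assume "open U" "x \<in> U"
    then obtain e where e: "e > 0" "\<And>y. dist y x < e \<Longrightarrow> y \<in> U"
      unfolding open_dist by blast
    obtain b where b: "b \<in> B" "Rep_unit_ivl x \<in> b" "b \<subseteq> ball (Rep_unit_ivl x) e"
      using topological_basisE[OF B(2), of "ball (Rep_unit_ivl x) e" "Rep_unit_ivl x"] e(1)
      by (metis centre_in_ball open_ball)
    have "Rep_unit_ivl -` b \<subseteq> U"
      using b(3) e(2) by (force simp: dist_unit_ivl_def dist_commute)
    then show "\<exists>b'\<in>?B. x \<in> b' \<and> b' \<subseteq> U"
      using b by blast
  qed
  moreover have "countable ?B" using B(1) by blast
  ultimately show "\<exists>B::unit_ivl set set. countable B \<and> open = generate_topology B"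
    using topological_basis_imp_subbasis by blast
qed

interpretation leb01: prob_space leb01
  by (rule prob_space_leb01)

interpretation leb01_pair: pair_prob_space leb01 leb01 ..

lemma space_leb01 [simp]: "space leb01 = UNIV"
  by (simp add: leb01_def)

lemma borel_measurable_leb01 [simp]: "borel_measurable leb01 = borel_measurable borel"
  by (rule measurable_cong_sets) simp_all

text \<open>Full support of the measure is what makes continuous versions unique: two continuous
  functions that differ somewhere differ on a nonempty open set.\<close>

lemma emeasure_leb01_open_pos:
  assumes "open U" "x \<in> U"
  shows "emeasure leb01 U \<noteq> 0"
proof -
  obtain e where e: "e > 0" "\<And>y. dist y x < e \<Longrightarrow> y \<in> U"
    using assms unfolding open_dist by blast
  define a b where "a = max 0 (Rep_unit_ivl x - e)" and "b = min 1 (Rep_unit_ivl x + e)"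
  have x01: "0 \<le> Rep_unit_ivl x" "Rep_unit_ivl x \<le> 1"
    using Rep_unit_ivl[of x] by auto
  have ab: "a < b"
    using x01 e(1) by (auto simp: a_def b_def)
  have sub: "{a<..<b} \<subseteq> Abs_unit_ivl -` U \<inter> {0..1}"
  proof
    fix y assume y: "y \<in> {a<..<b}"
    then have y01: "y \<in> {0..1}" by (auto simp: a_def b_def)
    have "dist (Abs_unit_ivl y) x < e"
      using y y01 by (auto simp: dist_unit_ivl_def Abs_unit_ivl_inverse dist_real_def a_def b_def)
    then show "y \<in> Abs_unit_ivl -` U \<inter> {0..1}"
      using y01 e(2) by simp
  qed
  have U: "U \<in> sets borel" using assms by auto
  have "emeasure leb01 U = emeasure (restrict_space lborel {0..1}) (Abs_unit_ivl -` U \<inter> {0..1})"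
    unfolding leb01_def using U
    by (subst emeasure_distr[OF measurable_Abs_unit_ivl]) (auto simp: space_restrict_space)
  moreover have "Abs_unit_ivl -` U \<inter> {0..1} \<in> sets (restrict_space lborel {0..1})"
    using measurable_sets[OF measurable_Abs_unit_ivl U] by (simp add: space_restrict_space)
  then have "Abs_unit_ivl -` U \<inter> {0..1} \<in> sets lborel"
    by (metis (no_types, lifting) borel_closed closed_atLeastAtMost sets.Int_space_eq2 sets_lborel
        sets_restrict_space_iff space_lborel UNIV_I)
  then have "emeasure lborel {a<..<b} \<le> emeasure lborel (Abs_unit_ivl -` U \<inter> {0..1})"
    by (intro emeasure_mono[OF sub])
  ultimately have "emeasure lborel {a<..<b} \<le> emeasure leb01 U"
    by (simp add: emeasure_restrict_space)
  then show ?thesis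
    using ab by (auto simp: emeasure_lborel_Ioo)
qed

lemma AE_leb01_continuous_eq:
  fixes f g :: "unit_ivl \<Rightarrow> real"
  assumes "AE x in leb01. f x = g x" "continuous_on UNIV f" "continuous_on UNIV g"
  shows "f x = g x"
proof (rule ccontr)
  assume ne: "f x \<noteq> g x"
  have "open {x. f x \<noteq> g x}"
    using open_Collect_neq assms(2,3) by blast
  moreover from this have "emeasure leb01 {x. f x \<noteq> g x} = 0"
    using assms(1) by (subst (asm) AE_iff_measurable[OF _ refl]) auto
  ultimately show False
    using emeasure_leb01_open_pos[of "{x. f x \<noteq> g x}" x] ne by auto
qed


subsection \<open>The inner product of \<open>L\<^sub>2[0,1]\<close>\<close>

lemma L2_measurable: "f \<in> L2 \<Longrightarrow> f \<in> borel_measurable borel"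
  by (simp add: L2_def)

lemma L2_integrable_mult:
  assumes "f \<in> L2" "g \<in> L2"
  shows "integrable leb01 (\<lambda>x. f x * g x)"
proof (rule Bochner_Integration.integrable_bound)
  show "integrable leb01 (\<lambda>x. (f x)\<^sup>2 + (g x)\<^sup>2)"
    using assms by (auto simp: L2_def)
  show "(\<lambda>x. f x * g x) \<in> borel_measurable leb01"
    using assms by (auto simp: L2_def)
  have "\<bar>a * b\<bar> \<le> a\<^sup>2 + b\<^sup>2" for a b :: real
  proof -
    have "0 \<le> \<bar>a\<bar> * \<bar>b\<bar>" by simp
    then show ?thesis
      using sum_squares_bound[of "\<bar>a\<bar>" "\<bar>b\<bar>"] unfolding abs_mult power2_abs by linarith
  qed
  then show "AE x in leb01. norm (f x * g x) \<le> norm ((f x)\<^sup>2 + (g x)\<^sup>2)"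
    by simp
qed

lemma L2_add: "f \<in> L2 \<Longrightarrow> g \<in> L2 \<Longrightarrow> (\<lambda>x. f x + g x) \<in> L2"
  using L2_integrable_mult[of f g]
  by (auto simp: L2_def power2_sum mult.assoc)

lemma L2_scale: "f \<in> L2 \<Longrightarrow> (\<lambda>x. c * f x) \<in> L2"
  by (auto simp: L2_def power_mult_distrib)

lemma L2_diff: "f \<in> L2 \<Longrightarrow> g \<in> L2 \<Longrightarrow> (\<lambda>x. f x - g x) \<in> L2"
  using L2_add[of f "\<lambda>x. (-1) * g x"] L2_scale[of g "-1"] by simp

lemma L2_sum:
  assumes "\<And>i. i \<in> I \<Longrightarrow> f i \<in> L2"
  shows "(\<lambda>x. \<Sum>i\<in>I. f i x) \<in> L2"
  using assms
proof (induction I rule: infinite_finite_induct)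
  case (insert i I)
  then show ?case using L2_add[of "f i" "\<lambda>x. \<Sum>i\<in>I. f i x"] by simp
qed (auto simp: L2_def)

lemma L2_bcontfun [simp]: "apply_bcontfun f \<in> L2" for f :: "unit_ivl \<Rightarrow>\<^sub>C real"
proof -
  have m: "apply_bcontfun f \<in> borel_measurable borel"
    by (intro borel_measurable_continuous_onI) simp
  have "\<bar>f x\<bar>\<^sup>2 \<le> (norm f)\<^sup>2" for x
    using norm_bounded[of f x] by (intro power_mono) auto
  then have "integrable leb01 (\<lambda>x. (f x)\<^sup>2)"
    using m by (intro leb01.integrable_const_bound[where B="(norm f)\<^sup>2"]) auto
  then show ?thesis using m by (simp add: L2_def)
qed

lemmas L2_intros = L2_add L2_scale L2_diff L2_sum L2_bcontfun

lemma L2_inner_commute: "L2_inner f g = L2_inner g f"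
  by (simp add: L2_inner_def mult.commute)

lemma L2_inner_add_left:
  "f \<in> L2 \<Longrightarrow> g \<in> L2 \<Longrightarrow> h \<in> L2 \<Longrightarrow> L2_inner (\<lambda>x. f x + g x) h = L2_inner f h + L2_inner g h"
  by (simp add: L2_inner_def distrib_right L2_integrable_mult)

lemma L2_inner_diff_left:
  "f \<in> L2 \<Longrightarrow> g \<in> L2 \<Longrightarrow> h \<in> L2 \<Longrightarrow> L2_inner (\<lambda>x. f x - g x) h = L2_inner f h - L2_inner g h"
  by (simp add: L2_inner_def left_diff_distrib L2_integrable_mult)

lemma L2_inner_scale_left: "L2_inner (\<lambda>x. c * f x) h = c * L2_inner f h"
  by (simp add: L2_inner_def mult.assoc)

lemma L2_inner_sum_left:
  assumes "\<And>i. i \<in> I \<Longrightarrow> f i \<in> L2" "h \<in> L2"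
  shows "L2_inner (\<lambda>x. \<Sum>i\<in>I. f i x) h = (\<Sum>i\<in>I. L2_inner (f i) h)"
  using assms
  by (simp add: L2_inner_def sum_distrib_right L2_integrable_mult Bochner_Integration.integral_sum)

lemma L2_inner_add_right:
  "f \<in> L2 \<Longrightarrow> g \<in> L2 \<Longrightarrow> h \<in> L2 \<Longrightarrow> L2_inner h (\<lambda>x. f x + g x) = L2_inner h f + L2_inner h g"
  by (simp add: L2_inner_commute[of h] L2_inner_add_left)

lemma L2_inner_diff_right:
  "f \<in> L2 \<Longrightarrow> g \<in> L2 \<Longrightarrow> h \<in> L2 \<Longrightarrow> L2_inner h (\<lambda>x. f x - g x) = L2_inner h f - L2_inner h g"
  by (simp add: L2_inner_commute[of h] L2_inner_diff_left)

lemma L2_inner_scale_right: "L2_inner h (\<lambda>x. c * f x) = c * L2_inner h f"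
  by (simp add: L2_inner_commute[of h] L2_inner_scale_left)

lemma L2_inner_sum_right:
  assumes "\<And>i. i \<in> I \<Longrightarrow> f i \<in> L2" "h \<in> L2"
  shows "L2_inner h (\<lambda>x. \<Sum>i\<in>I. f i x) = (\<Sum>i\<in>I. L2_inner h (f i))"
  using L2_inner_sum_left[OF assms] by (simp add: L2_inner_commute[of h])

lemmas L2_inner_simps = L2_inner_add_left L2_inner_diff_left L2_inner_scale_left L2_inner_sum_left
  L2_inner_add_right L2_inner_diff_right L2_inner_scale_right L2_inner_sum_right

lemma L2_inner_self_nonneg [simp]: "0 \<le> L2_inner f f"
  by (simp add: L2_inner_def)

lemma L2_norm_nonneg [simp]: "0 \<le> L2_norm f"
  by (simp add: L2_norm_def)

lemma L2_norm_power2: "(L2_norm f)\<^sup>2 = L2_inner f f"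
  by (simp add: L2_norm_def)

text \<open>The core of Cauchy-Schwarz, isolated as a statement about real numbers so that it serves
  both the \<open>L2\<close> inner product and the semidefinite form of \<open>s - T_G\<close> in
  \<open>ex_eigenvalue_ge\<close>.\<close>

lemma discriminant_nonpos:
  fixes a b c :: real
  assumes "\<And>t. 0 \<le> a + 2 * t * b + t\<^sup>2 * c"
  shows "b\<^sup>2 \<le> a * c"
proof (cases "c = 0")
  case True
  have "b = 0"
  proof (rule ccontr)
    assume "b \<noteq> 0"
    then show False using assms[of "- (a + 1) / (2 * b)"] True by (simp add: field_simps)
  qed
  then show ?thesis using True by simp
next
  case False
  have "c > 0"
  proof (rule ccontr)
    assume "\<not> c > 0"
    then have c: "c < 0" using False by simp
    \<comment> \<open>For negative \<open>c\<close> the quadratic is eventually negative. This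
      \<open>t\<close> is at least 1 and makes \<open>- t * c\<close> larger than
      \<open>\<bar>a\<bar> + 2 * \<bar>b\<bar>\<close>, which suffices.\<close>
    define t where "t = (\<bar>a\<bar> + 1 + 2 * \<bar>b\<bar>) / (- c) + 1"
    have "0 \<le> (\<bar>a\<bar> + 1 + 2 * \<bar>b\<bar>) / (- c)"
      using c by (intro divide_nonneg_pos) auto
    then have "t \<ge> 1" unfolding t_def by linarith
    have tc: "- t * c = \<bar>a\<bar> + 1 + 2 * \<bar>b\<bar> - c"
      using c by (simp add: t_def field_simps)
    have "t * (t * c) = - (t * (- t * c))" by simp
    also have "\<dots> = - (t * \<bar>a\<bar>) - t - 2 * (t * \<bar>b\<bar>) + t * c"
      unfolding tc by (simp add: algebra_simps)
    finally have "t * (t * c) = - (t * \<bar>a\<bar>) - t - 2 * (t * \<bar>b\<bar>) + t * c" .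
    moreover have "0 \<le> a + 2 * (t * b) + t * (t * c)"
      using assms[of t] by (simp add: power2_eq_square mult.assoc)
    moreover have "\<bar>a\<bar> \<le> t * \<bar>a\<bar>" using mult_right_mono[OF \<open>t \<ge> 1\<close>, of "\<bar>a\<bar>"] by simp
    moreover have "t * b \<le> t * \<bar>b\<bar>" using \<open>t \<ge> 1\<close> by (intro mult_left_mono) auto
    moreover have "t * c \<le> 0" using \<open>t \<ge> 1\<close> c by (simp add: mult_nonneg_nonpos)
    ultimately show False
      using \<open>t \<ge> 1\<close> by linarith
  qed
  then show ?thesis
    using assms[of "- b / c"] by (simp add: field_simps power2_eq_square)
qed

lemma L2_Cauchy_Schwarz:
  assumes "f \<in> L2" "g \<in> L2"
  shows "\<bar>L2_inner f g\<bar> \<le> L2_norm f * L2_norm g"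
proof -
  have "0 \<le> L2_inner f f + 2 * t * L2_inner f g + t\<^sup>2 * L2_inner g g" for t
    using L2_inner_self_nonneg[of "\<lambda>x. f x + t * g x"] assms
    by (simp add: L2_inner_simps L2_intros L2_inner_commute[of g f] power2_eq_square algebra_simps)
  then have "(L2_inner f g)\<^sup>2 \<le> (L2_norm f * L2_norm g)\<^sup>2"
    using discriminant_nonpos by (simp add: power_mult_distrib L2_norm_power2)
  then show ?thesis
    using abs_le_square_iff[of "L2_inner f g" "L2_norm f * L2_norm g"] by (simp add: abs_mult)
qed

lemma L2_norm_le_norm: "L2_norm (apply_bcontfun f) \<le> norm f" for f :: "unit_ivl \<Rightarrow>\<^sub>C real"
proof -
  have "\<bar>f x\<bar>\<^sup>2 \<le> (norm f)\<^sup>2" for x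
    using norm_bounded[of f x] by (intro power_mono) auto
  then have "(f x) * (f x) \<le> (norm f)\<^sup>2" for x
    by (simp add: power2_eq_square)
  then have "L2_inner f f \<le> (norm f)\<^sup>2"
    unfolding L2_inner_def using L2_integrable_mult[of f f] leb01.prob_space
    by (intro leb01.integral_le_const) auto
  then show ?thesis
    by (simp add: L2_norm_def real_le_lsqrt)
qed

lemma L2_norm_bcontfun_eq_0:
  fixes f :: "unit_ivl \<Rightarrow>\<^sub>C real"
  assumes "L2_inner f f = 0"
  shows "f = 0"
proof -
  have "AE x in leb01. f x * f x = 0"
    using assms L2_integrable_mult[of f f] unfolding L2_inner_def
    by (subst (asm) integral_nonneg_eq_0_iff_AE) auto
  then have "AE x in leb01. f x = 0" by simp
  from AE_leb01_continuous_eq[OF this] show ?thesis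
    by (intro bcontfun_eqI) simp
qed

lemma L2_inner_bcontfun_pos: "f \<noteq> 0 \<Longrightarrow> 0 < L2_inner f f" for f :: "unit_ivl \<Rightarrow>\<^sub>C real"
  using L2_norm_bcontfun_eq_0[of f] L2_inner_self_nonneg[of f] by (auto simp: less_le)

lemma apply_bcontfun_sum: "apply_bcontfun (\<Sum>i\<in>I. f i) x = (\<Sum>i\<in>I. f i x)"
  for f :: "_ \<Rightarrow> unit_ivl \<Rightarrow>\<^sub>C real"
  by (induction I rule: infinite_finite_induct) auto

lemma L2_inner_cong_AE:
  assumes "AE x in leb01. f x = f' x" "f \<in> L2" "f' \<in> L2" "g \<in> L2"
  shows "L2_inner f g = L2_inner f' g"
  unfolding L2_inner_def
  using assms(2-4)[THEN L2_measurable] assms(1)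
  by (intro integral_cong_AE) auto


subsection \<open>Integral operators\<close>

definition kernel_section :: "kernel \<Rightarrow> unit_ivl \<Rightarrow> (unit_ivl \<Rightarrow>\<^sub>C real)" where
  "kernel_section G x = Bcontfun (\<lambda>y. apply_bcontfun G (x, y))"

text \<open>The integral operator as a map from \<open>L2\<close> into the normed space of
  continuous functions. The value is meaningful once \<open>int_op G f\<close> is known to be
  continuous, hence the assumption \<open>f \<in> L2\<close> in the facts about it.\<close>

definition kernel_op :: "kernel \<Rightarrow> (unit_ivl \<Rightarrow> real) \<Rightarrow> (unit_ivl \<Rightarrow>\<^sub>C real)" where
  "kernel_op G f = Bcontfun (int_op G f)"

lemma apply_kernel_section [simp]: "apply_bcontfun (kernel_section G x) y = apply_bcontfun G (x, y)"
proof -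
  have "continuous_on UNIV (\<lambda>y. apply_bcontfun G (x, y))"
    by (rule continuous_on_compose2[OF continuous_on_apply_bcontfun]) (auto intro!: continuous_intros)
  then show ?thesis
    by (simp add: kernel_section_def bcontfun_unit_ivl Bcontfun_inverse)
qed

lemma norm_kernel_section: "norm (kernel_section G x) \<le> norm G"
  using norm_bounded[of G] by (intro norm_bound) auto

lemma int_op_eq_L2_inner: "int_op G f x = L2_inner (kernel_section G x) f"
  by (simp add: int_op_def L2_inner_def)

lemma abs_int_op_le:
  assumes "f \<in> L2"
  shows "\<bar>int_op G f x\<bar> \<le> norm G * L2_norm f"
proof -
  have "\<bar>int_op G f x\<bar> \<le> L2_norm (kernel_section G x) * L2_norm f"
    unfolding int_op_eq_L2_inner using assms by (intro L2_Cauchy_Schwarz) auto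
  also have "\<dots> \<le> norm G * L2_norm f"
    using L2_norm_le_norm[of "kernel_section G x"] norm_kernel_section[of G x]
    by (intro mult_right_mono) auto
  finally show ?thesis .
qed

text \<open>The modulus \<open>d\<close> comes from uniform continuity of the kernel on the compact
  square and does not depend on \<open>f\<close>. This yields both continuity of each image and the
  equicontinuity required by Arzela-Ascoli.\<close>

lemma int_op_equicontinuous:
  assumes "e > 0"
  shows "\<exists>d>0. \<forall>f\<in>L2. \<forall>x x'. dist x x' < d \<longrightarrow> \<bar>int_op G f x - int_op G f x'\<bar> \<le> e * L2_norm f"
proof -
  have "uniformly_continuous_on UNIV (apply_bcontfun G)"
    using compact_Times[OF compact_UNIV_unit_ivl compact_UNIV_unit_ivl]
    by (intro compact_uniformly_continuous) auto
  then obtain d where d: "d > 0" "\<And>p p'. dist p' p < d \<Longrightarrow> dist (G p') (G p) < e"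
    using assms unfolding uniformly_continuous_on_def by blast
  have "\<bar>int_op G f x - int_op G f x'\<bar> \<le> e * L2_norm f"
    if f: "f \<in> L2" and xx': "dist x x' < d" for f x x'
  proof -
    let ?D = "kernel_section G x - kernel_section G x'"
    have "norm ?D \<le> e"
    proof (rule norm_bound)
      fix y :: unit_ivl
      have "dist (x, y) (x', y) < d" using xx' by (simp add: dist_Pair_Pair)
      then show "norm (apply_bcontfun ?D y) \<le> e"
        using d(2)[of "(x, y)" "(x', y)"] by (simp add: dist_norm less_imp_le)
    qed
    have "int_op G f x - int_op G f x' = L2_inner ?D f"
      using f by (simp add: int_op_eq_L2_inner L2_inner_simps del: apply_kernel_section)
    also have "\<bar>\<dots>\<bar> \<le> L2_norm ?D * L2_norm f"
      using f by (intro L2_Cauchy_Schwarz L2_bcontfun)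
    also have "\<dots> \<le> e * L2_norm f"
      using L2_norm_le_norm[of ?D] \<open>norm ?D \<le> e\<close> by (intro mult_right_mono) auto
    finally show ?thesis .
  qed
  then show ?thesis using d(1) by blast
qed

lemma apply_kernel_op:
  assumes "f \<in> L2"
  shows "apply_bcontfun (kernel_op G f) x = int_op G f x"
proof -
  have "continuous_on UNIV (int_op G f)"
    unfolding continuous_on_iff
  proof (intro ballI allI impI)
    fix x :: unit_ivl and e :: real
    assume e: "0 < e"
    define e' where "e' = e / (2 * (L2_norm f + 1))"
    have Lpos: "0 < L2_norm f + 1" using L2_norm_nonneg[of f] by linarith
    then have e': "e' > 0" using e by (simp add: e'_def)
    have "e' * L2_norm f \<le> e' * (L2_norm f + 1)" using e' by simp
    also have "\<dots> = e / 2" using Lpos by (simp add: e'_def field_simps)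
    also have "\<dots> < e" using e by simp
    finally have less: "e' * L2_norm f < e" .
    obtain d where d: "d > 0"
      "\<forall>f\<in>L2. \<forall>x x'. dist x x' < d \<longrightarrow> \<bar>int_op G f x - int_op G f x'\<bar> \<le> e' * L2_norm f"
      using int_op_equicontinuous[OF e'] by blast
    have "dist (int_op G f x') (int_op G f x) < e" if "dist x' x < d" for x'
      using d(2) assms that less unfolding dist_real_def by fastforce
    then show "\<exists>d>0. \<forall>x'\<in>UNIV. dist x' x < d \<longrightarrow> dist (int_op G f x') (int_op G f x) < e"
      using d(1) by blast
  qed
  then show ?thesis
    by (simp add: kernel_op_def bcontfun_unit_ivl Bcontfun_inverse)
qed

lemma norm_kernel_op:
  assumes "f \<in> L2"
  shows "norm (kernel_op G f) \<le> norm G * L2_norm f"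
  using abs_int_op_le[OF assms] by (intro norm_bound) (simp add: apply_kernel_op[OF assms])

lemma kernel_op_eqI:
  assumes "f \<in> L2" "\<And>x. int_op G f x = apply_bcontfun g x"
  shows "kernel_op G f = g"
  using assms by (intro bcontfun_eqI) (simp add: apply_kernel_op)

lemma kernel_op_scale: "f \<in> L2 \<Longrightarrow> kernel_op G (\<lambda>x. c * f x) = c *\<^sub>R kernel_op G f"
  by (intro bcontfun_eqI) (simp add: apply_kernel_op L2_intros int_op_eq_L2_inner L2_inner_simps)

lemma kernel_op_sum: "(\<And>i. i \<in> I \<Longrightarrow> f i \<in> L2) \<Longrightarrow>
    kernel_op G (\<lambda>x. \<Sum>i\<in>I. f i x) = (\<Sum>i\<in>I. kernel_op G (f i))"
  by (intro bcontfun_eqI)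
    (simp add: apply_kernel_op L2_intros int_op_eq_L2_inner L2_inner_simps apply_bcontfun_sum)

lemma kernel_op_add_kernel: "f \<in> L2 \<Longrightarrow> kernel_op (G + H) f = kernel_op G f + kernel_op H f"
proof (intro bcontfun_eqI)
  fix x assume f: "f \<in> L2"
  have "kernel_section (G + H) x = kernel_section G x + kernel_section H x"
    by (intro bcontfun_eqI) simp
  then show "apply_bcontfun (kernel_op (G + H) f) x = apply_bcontfun (kernel_op G f + kernel_op H f) x"
    using f by (simp add: apply_kernel_op int_op_eq_L2_inner L2_inner_simps del: apply_kernel_section)
qed

lemma kernel_op_scale_kernel: "f \<in> L2 \<Longrightarrow> kernel_op (c *\<^sub>R G) f = c *\<^sub>R kernel_op G f"
proof (intro bcontfun_eqI)
  fix x assume f: "f \<in> L2"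
  have "kernel_section (c *\<^sub>R G) x = c *\<^sub>R kernel_section G x"
    by (intro bcontfun_eqI) simp
  then show "apply_bcontfun (kernel_op (c *\<^sub>R G) f) x = apply_bcontfun (c *\<^sub>R kernel_op G f) x"
    using f by (simp add: apply_kernel_op int_op_eq_L2_inner L2_inner_simps del: apply_kernel_section)
qed

lemma bounded_linear_kernel_op_kernel:
  assumes "f \<in> L2"
  shows "bounded_linear (\<lambda>G. kernel_op G f)"
  using norm_kernel_op[OF assms]
  by (intro bounded_linear_intro[where K="L2_norm f"])
    (auto simp: kernel_op_add_kernel[OF assms] kernel_op_scale_kernel[OF assms])

lemma kernel_op_diff_kernel: "f \<in> L2 \<Longrightarrow> kernel_op (G - H) f = kernel_op G f - kernel_op H f"
  using linear_diff[OF bounded_linear.linear[OF bounded_linear_kernel_op_kernel]] .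

lemma bounded_linear_kernel_op: "bounded_linear (\<lambda>f. kernel_op G (apply_bcontfun f))"
proof (rule bounded_linear_intro[where K="norm G"])
  fix f :: "unit_ivl \<Rightarrow>\<^sub>C real"
  have "norm (kernel_op G f) \<le> norm G * L2_norm f" by (rule norm_kernel_op) simp
  also have "\<dots> \<le> norm G * norm f" by (intro mult_left_mono L2_norm_le_norm) simp
  finally show "norm (kernel_op G f) \<le> norm f * norm G" by (simp add: mult.commute)
qed (auto intro!: bcontfun_eqI simp: apply_kernel_op int_op_eq_L2_inner L2_inner_simps L2_intros)

lemma bounded_linear_L2_inner:
  assumes "f \<in> L2"
  shows "bounded_linear (\<lambda>h. L2_inner (apply_bcontfun h) f)"
proof (rule bounded_linear_intro[where K="L2_norm f"])
  fix h :: "unit_ivl \<Rightarrow>\<^sub>C real"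
  have "\<bar>L2_inner h f\<bar> \<le> L2_norm h * L2_norm f" using assms by (intro L2_Cauchy_Schwarz) auto
  also have "\<dots> \<le> norm h * L2_norm f" by (intro mult_right_mono L2_norm_le_norm) simp
  finally show "norm (L2_inner h f) \<le> norm h * L2_norm f" by simp
qed (use assms in \<open>auto simp: L2_inner_simps\<close>)

text \<open>Continuity gives Borel measurability on the square, Fubini asks for the product
  sigma-algebra; they agree because \<open>unit_ivl\<close> is second countable.\<close>

lemma kernel_measurable: "apply_bcontfun G \<in> borel_measurable (leb01 \<Otimes>\<^sub>M leb01)"
proof -
  have "sets (leb01 \<Otimes>\<^sub>M leb01) = sets (borel :: (unit_ivl \<times> unit_ivl) measure)"
    by (metis borel_prod sets_leb01 sets_pair_measure_cong)
  then show ?thesis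
    by (subst measurable_cong_sets[OF _ refl])
      (auto intro: borel_measurable_continuous_onI continuous_on_apply_bcontfun)
qed

text \<open>Fubini, with \<open>norm G * \<bar>g x * f y\<bar>\<close> as dominating function; it is
  integrable since square integrable functions are integrable on a probability space.\<close>

lemma kernel_op_symmetric:
  assumes G: "symmetric_kernel G" and f: "f \<in> L2" and g: "g \<in> L2"
  shows "L2_inner (kernel_op G f) g = L2_inner f (kernel_op G g)"
proof -
  have int1: "integrable leb01 h" if "h \<in> L2" for h
    using L2_integrable_mult[OF that L2_bcontfun[of "const_bcontfun 1"]]
    by (simp add: const_bcontfun.rep_eq)
  have [measurable]: "f \<in> borel_measurable leb01" "g \<in> borel_measurable leb01"
    "apply_bcontfun G \<in> borel_measurable (leb01 \<Otimes>\<^sub>M leb01)"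
    using f g kernel_measurable by (auto simp: L2_def)
  let ?F = "\<lambda>(x, y). G (x, y) * f y * g x"
  have int_fg: "integrable (leb01 \<Otimes>\<^sub>M leb01) (\<lambda>(x, y). g x * f y)"
  proof (rule leb01_pair.Fubini_integrable)
    show "integrable leb01 (\<lambda>x. \<integral>y. norm (case (x, y) of (x, y) \<Rightarrow> g x * f y) \<partial>leb01)"
      using int1[OF g] by (simp add: abs_mult)
    show "AE x in leb01. integrable leb01 (\<lambda>y. case (x, y) of (x, y) \<Rightarrow> g x * f y)"
      using int1[OF f] by simp
  qed measurable
  have int_F: "integrable (leb01 \<Otimes>\<^sub>M leb01) ?F"
  proof (rule Bochner_Integration.integrable_bound)
    show "integrable (leb01 \<Otimes>\<^sub>M leb01) (\<lambda>p. norm G * (case p of (x, y) \<Rightarrow> g x * f y))"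
      using int_fg by simp
    show "AE p in leb01 \<Otimes>\<^sub>M leb01. norm (?F p) \<le> norm (norm G * (case p of (x, y) \<Rightarrow> g x * f y))"
    proof (rule AE_I2)
      fix p :: "unit_ivl \<times> unit_ivl"
      obtain x y where p: "p = (x, y)" by (cases p)
      have "\<bar>G (x, y)\<bar> * \<bar>g x * f y\<bar> \<le> norm G * \<bar>g x * f y\<bar>"
        using norm_bounded[of G "(x, y)"] by (intro mult_right_mono) auto
      then show "norm (?F p) \<le> norm (norm G * (case p of (x, y) \<Rightarrow> g x * f y))"
        by (simp add: p abs_mult mult_ac)
    qed
  qed measurable
  have "L2_inner (kernel_op G f) g = (\<integral>x. (\<integral>y. G (x, y) * f y * g x \<partial>leb01) \<partial>leb01)"
    using f by (simp add: L2_inner_def apply_kernel_op int_op_def)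
  also have "\<dots> = (\<integral>y. (\<integral>x. G (x, y) * f y * g x \<partial>leb01) \<partial>leb01)"
    using leb01_pair.Fubini_integral[OF int_F] by simp
  also have "\<dots> = (\<integral>y. (\<integral>x. f y * (G (y, x) * g x) \<partial>leb01) \<partial>leb01)"
    using G by (simp add: symmetric_kernel_def mult_ac)
  also have "\<dots> = L2_inner f (kernel_op G g)"
    using g by (simp add: L2_inner_def apply_kernel_op int_op_def)
  finally show ?thesis .
qed


subsection \<open>Orthonormal families\<close>

definition orthonormal_family :: "'i set \<Rightarrow> ('i \<Rightarrow> unit_ivl \<Rightarrow> real) \<Rightarrow> bool" where
  "orthonormal_family I e \<longleftrightarrow>
     (\<forall>i\<in>I. e i \<in> L2) \<and> (\<forall>i\<in>I. \<forall>j\<in>I. L2_inner (e i) (e j) = (if i = j then 1 else 0))"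

lemma orthonormal_familyD:
  assumes "orthonormal_family I e"
  shows "i \<in> I \<Longrightarrow> e i \<in> L2"
    and "i \<in> I \<Longrightarrow> j \<in> I \<Longrightarrow> L2_inner (e i) (e j) = (if i = j then 1 else 0)"
  using assms by (auto simp: orthonormal_family_def)

lemma orthonormal_family_subset:
  "orthonormal_family J e \<Longrightarrow> I \<subseteq> J \<Longrightarrow> orthonormal_family I e"
  unfolding orthonormal_family_def by blast

lemma L2_inner_lincomb_left:
  assumes "orthonormal_family I e" "finite I" "i \<in> I"
  shows "L2_inner (\<lambda>x. \<Sum>j\<in>I. c j * e j x) (e i) = c i"
proof -
  have "L2_inner (\<lambda>x. \<Sum>j\<in>I. c j * e j x) (e i) = (\<Sum>j\<in>I. c j * L2_inner (e j) (e i))"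
    using orthonormal_familyD(1)[OF assms(1)] assms(3)
    by (simp add: L2_inner_simps L2_intros)
  also have "\<dots> = (\<Sum>j\<in>I. if j = i then c j else 0)"
    using orthonormal_familyD(2)[OF assms(1) _ assms(3)] by (intro sum.cong) auto
  finally show ?thesis using assms by simp
qed

lemma L2_inner_lincomb:
  assumes "orthonormal_family I e" "finite I"
  shows "L2_inner (\<lambda>x. \<Sum>j\<in>I. c j * e j x) (\<lambda>x. \<Sum>j\<in>I. d j * e j x) = (\<Sum>j\<in>I. c j * d j)"
proof -
  have L2: "(\<lambda>x. c j * e j x) \<in> L2" if "j \<in> I" for c j
    using orthonormal_familyD(1)[OF assms(1) that] by (rule L2_scale)
  have "L2_inner (\<lambda>x. \<Sum>j\<in>I. c j * e j x) (\<lambda>x. \<Sum>j\<in>I. d j * e j x)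
      = (\<Sum>i\<in>I. d i * L2_inner (\<lambda>x. \<Sum>j\<in>I. c j * e j x) (e i))"
    using L2 by (subst L2_inner_sum_right) (auto intro: L2_sum simp: L2_inner_scale_right)
  then show ?thesis
    using L2_inner_lincomb_left[OF assms] by (simp add: mult.commute)
qed

lemma L2_Bessel:
  assumes "orthonormal_family I e" "finite I" "h \<in> L2"
  shows "(\<Sum>i\<in>I. (L2_inner h (e i))\<^sup>2) \<le> L2_inner h h"
proof -
  let ?s = "\<lambda>x. \<Sum>i\<in>I. L2_inner h (e i) * e i x"
  have L2: "(\<lambda>x. c * e j x) \<in> L2" if "j \<in> I" for c j
    using orthonormal_familyD(1)[OF assms(1) that] by (rule L2_scale)
  then have s: "?s \<in> L2" by (intro L2_sum) auto
  have hs: "L2_inner h ?s = (\<Sum>i\<in>I. (L2_inner h (e i))\<^sup>2)"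
    using L2 assms(3) by (subst L2_inner_sum_right) (auto simp: L2_inner_scale_right power2_eq_square)
  have ss: "L2_inner ?s ?s = (\<Sum>i\<in>I. (L2_inner h (e i))\<^sup>2)"
    using L2_inner_lincomb[OF assms(1,2)] by (simp add: power2_eq_square)
  have "0 \<le> L2_inner (\<lambda>x. h x - ?s x) (\<lambda>x. h x - ?s x)" by (rule L2_inner_self_nonneg)
  also have "\<dots> = L2_inner h h - (\<Sum>i\<in>I. (L2_inner h (e i))\<^sup>2)"
    using s assms(3) L2_inner_commute[of ?s h]
    by (simp only: L2_inner_diff_left L2_inner_diff_right L2_diff hs ss)
  finally show ?thesis by simp
qed

lemma orthonormal_family_independent:
  assumes "orthonormal_family B apply_bcontfun" "finite B"
  shows "independent (B :: (unit_ivl \<Rightarrow>\<^sub>C real) set)"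
proof (subst independent_explicit_finite_subsets, intro allI impI ballI)
  fix S u v
  assume S: "S \<subseteq> B" "finite S" and sum0: "(\<Sum>v\<in>S. u v *\<^sub>R v) = 0" and v: "v \<in> S"
  have "(\<Sum>w\<in>S. u w * w x) = 0" for x
    using arg_cong[OF sum0, of "\<lambda>f. apply_bcontfun f x"] by (simp add: apply_bcontfun_sum)
  then show "u v = 0"
    using L2_inner_lincomb_left[OF orthonormal_family_subset[OF assms(1) S(1)] S(2) v, of u]
    by (simp add: L2_inner_def)
qed

text \<open>Gaussian elimination, one equation and one unknown at a time. It supplies every
  dimension count in the min-max arguments: a nonzero combination of \<open>card A\<close> functions
  can be made orthogonal to fewer than \<open>card A\<close> given ones.\<close>

lemma homogeneous_system_nontrivial_solution:
  fixes a :: "'i \<Rightarrow> 'j \<Rightarrow> real"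
  assumes "finite I" "finite A" "card I < card A"
  shows "\<exists>c. (\<exists>j\<in>A. c j \<noteq> 0) \<and> (\<forall>i\<in>I. (\<Sum>j\<in>A. a i j * c j) = 0)"
  using assms
proof (induction I arbitrary: A a rule: finite_induct)
  case empty
  then have "A \<noteq> {}" by auto
  then show ?case by (intro exI[of _ "\<lambda>_. 1"]) auto
next
  case (insert i I)
  show ?case
  proof (cases "\<forall>j\<in>A. a i j = 0")
    case True
    have "card I < card A" using insert by simp
    then obtain c where c: "\<exists>j\<in>A. c j \<noteq> 0" "\<forall>i\<in>I. (\<Sum>j\<in>A. a i j * c j) = 0"
      using insert.IH[OF \<open>finite A\<close>, of a] by blast
    then show ?thesis using True by (intro exI[of _ c]) auto
  next
    case False
    then obtain j where j: "j \<in> A" "a i j \<noteq> 0" by blast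
    \<comment> \<open>The coefficients that remain after equation \<open>i\<close> has been used to
      eliminate the unknown \<open>j\<close>.\<close>
    define b where "b i' j' = a i' j' - a i' j * a i j' / a i j" for i' j'
    have "card I < card (A - {j})"
      using insert j by auto
    then obtain c where c: "\<exists>j'\<in>A - {j}. c j' \<noteq> 0" "\<forall>i\<in>I. (\<Sum>j'\<in>A - {j}. b i j' * c j') = 0"
      using insert.IH[OF finite_Diff[OF \<open>finite A\<close>], of "{j}" b] by blast
    \<comment> \<open>Equation \<open>i\<close> forces the value \<open>- s\<close> on the
      eliminated unknown.\<close>
    define s where "s = (\<Sum>j'\<in>A - {j}. a i j' * c j') / a i j"
    define c' where "c' = c(j := - s)"
    have eq: "(\<Sum>j'\<in>A. a i' j' * c' j') = (\<Sum>j'\<in>A - {j}. a i' j' * c j') - a i' j * s" for i'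
    proof -
      have "(\<Sum>j'\<in>A. a i' j' * c' j') = a i' j * c' j + (\<Sum>j'\<in>A - {j}. a i' j' * c' j')"
        using insert j by (intro sum.remove) auto
      moreover have "(\<Sum>j'\<in>A - {j}. a i' j' * c' j') = (\<Sum>j'\<in>A - {j}. a i' j' * c j')"
        by (intro sum.cong) (auto simp: c'_def)
      ultimately show ?thesis by (simp add: c'_def)
    qed
    have "(\<Sum>j'\<in>A. a i' j' * c' j') = 0" if "i' \<in> insert i I" for i'
    proof (cases "i' = i")
      case True
      then show ?thesis unfolding eq using j by (simp add: s_def)
    next
      case False
      then have "(\<Sum>j'\<in>A - {j}. b i' j' * c j') = 0" using c that by auto
      then show ?thesis unfolding eq
        by (simp add: b_def s_def sum_subtractf sum_distrib_left sum_divide_distrib algebra_simps)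
    qed
    moreover have "\<exists>j\<in>A. c' j \<noteq> 0" using c(1) by (auto simp: c'_def)
    ultimately show ?thesis by blast
  qed
qed


subsection \<open>Counting eigenvalues\<close>

lemma eigenspace_iff: "f \<in> eigenspace G \<mu> \<longleftrightarrow> kernel_op G f = \<mu> *\<^sub>R f"
proof
  assume "f \<in> eigenspace G \<mu>"
  then show "kernel_op G f = \<mu> *\<^sub>R f"
    by (intro kernel_op_eqI) (auto simp: eigenspace_def)
next
  assume "kernel_op G f = \<mu> *\<^sub>R f"
  then have "apply_bcontfun (kernel_op G f) x = \<mu> * f x" for x by simp
  then show "f \<in> eigenspace G \<mu>" by (simp add: eigenspace_def apply_kernel_op)
qed

lemma subspace_eigenspace: "subspace (eigenspace G \<mu>)"
proof -
  interpret bounded_linear "\<lambda>f. kernel_op G (apply_bcontfun f)" by (rule bounded_linear_kernel_op)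
  show ?thesis
    by (rule subspaceI) (auto simp: eigenspace_iff zero add scaleR scaleR_add_right
        simp del: plus_bcontfun.rep_eq scaleR_bcontfun.rep_eq zero_bcontfun.rep_eq)
qed

lemma eigenspace_unique:
  assumes "f \<in> eigenspace G \<mu>" "f \<in> eigenspace G \<nu>" "f \<noteq> 0"
  shows "\<mu> = \<nu>"
  using assms by (simp add: eigenspace_iff)

lemma eigenspace_orthogonal:
  assumes "symmetric_kernel G" "f \<in> eigenspace G \<mu>" "g \<in> eigenspace G \<nu>" "\<mu> \<noteq> \<nu>"
  shows "L2_inner f g = 0"
proof -
  have "\<mu> * L2_inner f g = \<nu> * L2_inner f g"
    using kernel_op_symmetric[OF assms(1), of f g] assms(2,3)
    by (simp add: eigenspace_iff L2_inner_simps)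
  then show ?thesis using assms(4) by simp
qed

text \<open>A Hilbert-Schmidt bound: for fixed \<open>x\<close> the numbers
  \<open>\<mu> e * e x\<close> are the coefficients of the section at \<open>x\<close>, so Bessel
  bounds their squares, and integration over \<open>x\<close> leaves the sum of the squared
  eigenvalues.\<close>

lemma card_eigenfunctions_le:
  assumes E: "orthonormal_family E apply_bcontfun" "finite E"
    and t: "t > 0" and ev: "\<forall>e\<in>E. \<exists>\<mu>\<ge>t. e \<in> eigenspace G \<mu>"
  shows "real (card E) * t\<^sup>2 \<le> (norm G)\<^sup>2"
proof -
  obtain \<mu> where \<mu>: "\<And>e. e \<in> E \<Longrightarrow> \<mu> e \<ge> t" "\<And>e. e \<in> E \<Longrightarrow> e \<in> eigenspace G (\<mu> e)"
    using ev by metis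
  have pointwise: "(\<Sum>e\<in>E. (\<mu> e)\<^sup>2 * (e x * e x)) \<le> (norm G)\<^sup>2" for x
  proof -
    have "(\<Sum>e\<in>E. (\<mu> e)\<^sup>2 * (e x * e x)) = (\<Sum>e\<in>E. (L2_inner (kernel_section G x) (apply_bcontfun e))\<^sup>2)"
    proof (rule sum.cong)
      fix e assume "e \<in> E"
      then have "L2_inner (kernel_section G x) e = \<mu> e * e x"
        using \<mu>(2) by (auto simp: eigenspace_def simp flip: int_op_eq_L2_inner)
      then show "(\<mu> e)\<^sup>2 * (e x * e x) = (L2_inner (kernel_section G x) e)\<^sup>2"
        by (simp add: power2_eq_square)
    qed simp
    also have "\<dots> \<le> (L2_norm (kernel_section G x))\<^sup>2"
      unfolding L2_norm_power2 by (rule L2_Bessel[OF E L2_bcontfun])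
    also have "\<dots> \<le> (norm G)\<^sup>2"
      using L2_norm_le_norm[of "kernel_section G x"] norm_kernel_section[of G x]
      by (intro power_mono) auto
    finally show ?thesis .
  qed
  have "real (card E) * t\<^sup>2 = (\<Sum>e\<in>E. t\<^sup>2)" by simp
  also have "\<dots> \<le> (\<Sum>e\<in>E. (\<mu> e)\<^sup>2)"
    using \<mu>(1) t by (intro sum_mono power_mono) auto
  also have "\<dots> = (\<Sum>e\<in>E. (\<mu> e)\<^sup>2 * L2_inner e e)"
    using orthonormal_familyD(2)[OF E(1)] by simp
  also have "\<dots> = (\<integral>x. (\<Sum>e\<in>E. (\<mu> e)\<^sup>2 * (e x * e x)) \<partial>leb01)"
    by (subst Bochner_Integration.integral_sum) (auto simp: L2_integrable_mult L2_inner_def)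
  also have "\<dots> \<le> (norm G)\<^sup>2"
    using pointwise by (intro leb01.integral_le_const) (auto simp: L2_integrable_mult)
  finally show ?thesis .
qed

text \<open>An orthonormal family of eigenfunctions of maximal cardinality, which exists because
  cardinalities are bounded. Maximality makes it span each eigenspace with \<mu> at least
  \<open>t\<close>, so \<open>eigenvalue_count\<close>, built from sums and dimensions that are 0 in
  infinite cases, becomes an honest cardinality.\<close>

lemma ex_complete_eigensystem:
  assumes G: "symmetric_kernel G" and t: "t > 0"
  shows "\<exists>E :: (unit_ivl \<Rightarrow>\<^sub>C real) set. finite E \<and> orthonormal_family E apply_bcontfun \<and>
    (\<forall>e\<in>E. \<exists>\<mu>\<ge>t. e \<in> eigenspace G \<mu>) \<and>
    (\<forall>\<mu>\<ge>t. \<forall>f\<in>eigenspace G \<mu>. (\<forall>e\<in>E. L2_inner (apply_bcontfun f) e = 0) \<longrightarrow> f = 0) \<and>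
    finite {\<mu>. t \<le> \<mu> \<and> is_eigenvalue G \<mu>} \<and> card E = eigenvalue_count G t"
proof -
  define P :: "(unit_ivl \<Rightarrow>\<^sub>C real) set \<Rightarrow> bool" where "P E \<longleftrightarrow> finite E \<and> orthonormal_family E apply_bcontfun \<and>
    (\<forall>e\<in>E. \<exists>\<mu>\<ge>t. e \<in> eigenspace G \<mu>)" for E
  have bound: "\<forall>E. P E \<longrightarrow> card E < Suc (nat \<lceil>(norm G)\<^sup>2 / t\<^sup>2\<rceil>)"
  proof (intro allI impI)
    fix E assume "P E"
    then have "real (card E) * t\<^sup>2 \<le> (norm G)\<^sup>2"
      using t by (intro card_eigenfunctions_le) (auto simp: P_def)
    then have "real (card E) \<le> (norm G)\<^sup>2 / t\<^sup>2" using t by (simp add: field_simps)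
    then have "real (card E) \<le> real (nat \<lceil>(norm G)\<^sup>2 / t\<^sup>2\<rceil>)"
      using real_nat_ceiling_ge by (rule order_trans)
    then show "card E < Suc (nat \<lceil>(norm G)\<^sup>2 / t\<^sup>2\<rceil>)"
      by (simp only: of_nat_le_iff less_Suc_eq_le)
  qed
  have "P {}" by (simp add: P_def orthonormal_family_def)
  from ex_has_greatest_nat[of P "{}" card, OF this bound]
  obtain E where PE: "P E" and max: "\<forall>F. P F \<longrightarrow> card F \<le> card E"
    by (elim exE conjE)
  have fin: "finite E" and on: "orthonormal_family E apply_bcontfun"
    and ev: "\<forall>e\<in>E. \<exists>\<mu>\<ge>t. e \<in> eigenspace G \<mu>"
    using PE by (auto simp: P_def)
  have complete: "f = 0"
    if f: "\<mu> \<ge> t" "f \<in> eigenspace G \<mu>" "\<forall>e\<in>E. L2_inner f e = 0" for \<mu> and f :: "unit_ivl \<Rightarrow>\<^sub>C real"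
  proof (rule ccontr)
    assume "f \<noteq> 0"
    then have pos: "0 < L2_inner f f" by (rule L2_inner_bcontfun_pos)
    define c where "c = 1 / L2_norm f"
    have cc: "c * (c * L2_inner f f) = 1"
      using pos by (simp add: c_def L2_norm_def field_simps)
    have e1: "L2_inner (c *\<^sub>R f) (c *\<^sub>R f) = 1"
      using cc by (simp add: L2_inner_simps)
    have e0: "L2_inner (c *\<^sub>R f) e = 0" "L2_inner e (c *\<^sub>R f) = 0" if "e \<in> E" for e
      using f(3) that L2_inner_commute[of e f] by (auto simp: L2_inner_simps)
    have "c *\<^sub>R f \<notin> E"
      using e0(1) e1 by (metis zero_neq_one)
    moreover have "c *\<^sub>R f \<in> eigenspace G \<mu>"
      using subspace_scale[OF subspace_eigenspace f(2)] .
    then have "P (insert (c *\<^sub>R f) E)"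
      unfolding P_def orthonormal_family_def
      using fin ev f(1) e1 e0 orthonormal_familyD(2)[OF on] \<open>c *\<^sub>R f \<notin> E\<close>
      by (auto simp del: scaleR_bcontfun.rep_eq)
    ultimately show False
      using max fin by fastforce
  qed
  define M where "M = {\<mu>. t \<le> \<mu> \<and> is_eigenvalue G \<mu>}"
  have nz: "e \<noteq> 0" if "e \<in> E" for e
    using orthonormal_familyD(2)[OF on that that] by (auto simp: L2_inner_def)
  have span: "eigenspace G \<mu> \<subseteq> span (E \<inter> eigenspace G \<mu>)" if \<mu>: "\<mu> \<ge> t" for \<mu>
  proof
    fix f assume f: "f \<in> eigenspace G \<mu>"
    let ?B = "E \<inter> eigenspace G \<mu>"
    let ?s = "\<Sum>e\<in>?B. L2_inner (apply_bcontfun f) (apply_bcontfun e) *\<^sub>R e"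
    have s_apply: "apply_bcontfun ?s = (\<lambda>x. \<Sum>e\<in>?B. L2_inner f (apply_bcontfun e) * e x)"
      by (auto simp: apply_bcontfun_sum)
    have s: "?s \<in> eigenspace G \<mu>"
      by (intro subspace_sum subspace_scale subspace_eigenspace) auto
    then have r: "f - ?s \<in> eigenspace G \<mu>"
      using f subspace_diff[OF subspace_eigenspace] by blast
    \<comment> \<open>Subtracting the projection handles the members of \<open>E\<close> in this
      eigenspace; all others are orthogonal because they belong to different eigenvalues.\<close>
    have "L2_inner (f - ?s) e = 0" if e: "e \<in> E" for e
    proof (cases "e \<in> ?B")
      case True
      have "L2_inner ?s e = L2_inner f e"
        unfolding s_apply using fin on True
        by (intro L2_inner_lincomb_left) (auto intro: orthonormal_family_subset)
      moreover have "L2_inner (f - ?s) e = L2_inner f e - L2_inner ?s e"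
        by (simp add: L2_inner_diff_left del: s_apply)
      ultimately show ?thesis by simp
    next
      case False
      then obtain \<nu> where \<nu>: "e \<in> eigenspace G \<nu>" "\<nu> \<noteq> \<mu>" using ev e by auto
      show ?thesis by (rule eigenspace_orthogonal[OF G r \<nu>(1) \<nu>(2)[symmetric]])
    qed
    then have "f - ?s = 0" using complete[OF \<mu> r] by blast
    moreover have "?s \<in> span ?B" by (intro span_sum span_scale span_base) auto
    ultimately show "f \<in> span ?B" by simp
  qed
  have mult: "multiplicity_of G \<mu> = card (E \<inter> eigenspace G \<mu>)" if "\<mu> \<ge> t" for \<mu>
    unfolding multiplicity_of_def
  proof (rule dim_unique[OF _ span[OF that]])
    show "independent (E \<inter> eigenspace G \<mu>)"
      by (rule orthonormal_family_independent[OF orthonormal_family_subset[OF on]]) (simp_all add: fin)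
  qed simp_all
  have ne: "\<exists>e\<in>E. e \<in> eigenspace G \<mu>" if "\<mu> \<in> M" for \<mu>
  proof (rule ccontr)
    assume "\<not> ?thesis"
    then have "E \<inter> eigenspace G \<mu> = {}" by blast
    then have "eigenspace G \<mu> \<subseteq> {0}" using span[of \<mu>] that by (simp add: M_def)
    then show False using that by (auto simp: M_def is_eigenvalue_def)
  qed
  \<comment> \<open>The choice is determined: a nonzero function is an eigenfunction for at most one
    eigenvalue.\<close>
  have "M \<subseteq> (\<lambda>e. SOME \<mu>. e \<in> eigenspace G \<mu>) ` E"
  proof
    fix \<mu> assume "\<mu> \<in> M"
    then obtain e where e: "e \<in> E" "e \<in> eigenspace G \<mu>" using ne by blast
    then have "(SOME \<mu>. e \<in> eigenspace G \<mu>) = \<mu>"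
      using eigenspace_unique[OF _ _ nz[OF e(1)]] by (intro some_equality) auto
    then show "\<mu> \<in> (\<lambda>e. SOME \<mu>. e \<in> eigenspace G \<mu>) ` E" using e by (metis imageI)
  qed
  then have finM: "finite M" using fin finite_surj by blast
  have "E = (\<Union>\<mu>\<in>M. E \<inter> eigenspace G \<mu>)"
    using ev nz by (fastforce simp: M_def is_eigenvalue_def)
  then have "card E = card (\<Union>\<mu>\<in>M. E \<inter> eigenspace G \<mu>)" by simp
  also have "\<dots> = (\<Sum>\<mu>\<in>M. card (E \<inter> eigenspace G \<mu>))"
    using finM fin nz eigenspace_unique by (intro card_UN_disjoint) blast+
  also have "\<dots> = eigenvalue_count G t"
    unfolding eigenvalue_count_def M_def[symmetric] using mult by (auto simp: M_def)
  finally have "card E = eigenvalue_count G t" .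
  then show ?thesis
    using fin on ev complete finM unfolding M_def by blast
qed


subsection \<open>Existence of eigenvalues and the min-max principle\<close>

text \<open>Arzela-Ascoli, applied to the functions transported to the real interval; the limit is
  pulled back afterwards. An \<open>L2\<close> bound on the arguments is turned into uniform
  convergence of the images.\<close>

lemma kernel_op_compact:
  assumes f: "\<And>n. f n \<in> L2" "\<And>n. L2_norm (f n) \<le> 1"
  obtains g r where "strict_mono (r :: nat \<Rightarrow> nat)" "(\<lambda>n. kernel_op G (f (r n))) \<longlonglongrightarrow> g"
proof -
  let ?F = "\<lambda>n x. apply_bcontfun (kernel_op G (f n)) (Abs_unit_ivl x)"
  have bound: "norm (?F n x) \<le> norm G" for n x
  proof -
    have "norm (?F n x) \<le> norm G * L2_norm (f n)"
      using abs_int_op_le[OF f(1)] by (simp add: apply_kernel_op[OF f(1)])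
    also have "\<dots> \<le> norm G * 1" by (intro mult_left_mono f(2)) simp
    finally show ?thesis by simp
  qed
  have equi: "\<exists>d>0. \<forall>n y. y \<in> {0..1} \<and> norm (x - y) < d \<longrightarrow> norm (?F n x - ?F n y) < e"
    if x: "x \<in> {0..1}" and e: "e > 0" for x e :: real
  proof -
    obtain d where d: "d > 0"
      "\<forall>f\<in>L2. \<forall>x x'. dist x x' < d \<longrightarrow> \<bar>int_op G f x - int_op G f x'\<bar> \<le> e / 2 * L2_norm f"
      using int_op_equicontinuous[of "e / 2" G] e by auto
    have "norm (?F n x - ?F n y) < e" if y: "y \<in> {0..1}" "norm (x - y) < d" for n y
    proof -
      have "dist (Abs_unit_ivl x) (Abs_unit_ivl y) < d"
        using x y by (simp add: dist_unit_ivl_def Abs_unit_ivl_inverse dist_real_def)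
      then have "norm (?F n x - ?F n y) \<le> e / 2 * L2_norm (f n)"
        using d(2) f(1) by (simp add: apply_kernel_op[OF f(1)])
      also have "\<dots> \<le> e / 2 * 1" using e by (intro mult_left_mono f(2)) simp
      also have "\<dots> < e" using e by simp
      finally show ?thesis .
    qed
    then show ?thesis using d(1) by blast
  qed
  obtain g r where g: "continuous_on {0..1} g" and r: "strict_mono (r :: nat \<Rightarrow> nat)"
    and conv: "\<And>e. 0 < e \<Longrightarrow> \<exists>N. \<forall>n x. n \<ge> N \<and> x \<in> {0..1} \<longrightarrow> norm (?F (r n) x - g x) < e"
    using Arzela_Ascoli[of "{0..1::real}" ?F "norm G", OF compact_Icc bound equi] by auto
  have cont: "continuous_on UNIV (\<lambda>u. g (Rep_unit_ivl u))"
  proof (rule continuous_on_compose2[OF g])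
    show "continuous_on UNIV Rep_unit_ivl"
      unfolding continuous_on_iff by (auto simp: dist_unit_ivl_def)
    show "range Rep_unit_ivl \<subseteq> {0..1}" using Rep_unit_ivl by auto
  qed
  define h where "h = Bcontfun (\<lambda>u. g (Rep_unit_ivl u))"
  have h: "apply_bcontfun h u = g (Rep_unit_ivl u)" for u
    using cont by (simp add: h_def bcontfun_unit_ivl Bcontfun_inverse)
  have "(\<lambda>n. kernel_op G (f (r n))) \<longlonglongrightarrow> h"
  proof (rule metric_LIMSEQ_I)
    fix e :: real assume e: "e > 0"
    obtain N where N: "\<And>n x. n \<ge> N \<Longrightarrow> x \<in> {0..1} \<Longrightarrow> norm (?F (r n) x - g x) < e / 2"
      using conv[of "e / 2"] e by auto
    have "dist (kernel_op G (f (r n))) h < e" if "n \<ge> N" for n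
    proof -
      have "norm (kernel_op G (f (r n)) - h) \<le> e / 2"
      proof (rule norm_bound)
        fix u
        show "norm (apply_bcontfun (kernel_op G (f (r n)) - h) u) \<le> e / 2"
          using N[OF that Rep_unit_ivl[of u]] by (simp add: h Rep_unit_ivl_inverse)
      qed
      then show ?thesis using e by (simp add: dist_norm)
    qed
    then show "\<exists>N. \<forall>n\<ge>N. dist (kernel_op G (f (r n))) h < e" by blast
  qed
  then show thesis using r that by blast
qed

lemma kernel_op_quadratic_le:
  "\<bar>L2_inner (kernel_op G f) f\<bar> \<le> norm G * L2_inner f f" for f :: "unit_ivl \<Rightarrow>\<^sub>C real"
proof -
  have "\<bar>L2_inner (kernel_op G f) f\<bar> \<le> L2_norm (kernel_op G f) * L2_norm f"
    by (intro L2_Cauchy_Schwarz) auto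
  also have "\<dots> \<le> (norm G * L2_norm f) * L2_norm f"
    by (intro mult_right_mono order_trans[OF L2_norm_le_norm norm_kernel_op]) auto
  also have "\<dots> = norm G * L2_inner f f"
    by (simp add: power2_eq_square flip: L2_norm_power2)
  finally show ?thesis .
qed

text \<open>The supremum \<open>s\<close> of the quadratic form over continuous unit functions is an
  eigenvalue. A maximizing sequence need not converge in the supremum norm, so the eigenfunction is
  obtained as a limit of the images \<open>kernel_op G (f n)\<close>.\<close>

lemma ex_eigenvalue_ge:
  fixes f0 :: "unit_ivl \<Rightarrow>\<^sub>C real"
  assumes G: "symmetric_kernel G" and t: "0 \<le> t" and f0: "t * L2_inner f0 f0 < L2_inner (kernel_op G f0) f0"
  shows "\<exists>s>t. \<exists>g\<in>eigenspace G s. g \<noteq> 0"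
proof -
  define q where "q f = L2_inner (kernel_op G f) f" for f :: "unit_ivl \<Rightarrow>\<^sub>C real"
  define n2 where "n2 f = L2_inner f f" for f :: "unit_ivl \<Rightarrow>\<^sub>C real"
  define s where "s = Sup (q ` {f. n2 f = 1})"
  interpret T: bounded_linear "\<lambda>f. kernel_op G (apply_bcontfun f)" by (rule bounded_linear_kernel_op)
  have bdd: "bdd_above (q ` {f. n2 f = 1})"
  proof (rule bdd_aboveI2)
    fix f assume "f \<in> {f. n2 f = 1}"
    then show "q f \<le> norm G" using kernel_op_quadratic_le[of G f] by (auto simp: q_def n2_def)
  qed
  have q_scale: "q (c *\<^sub>R f) = c\<^sup>2 * q f" for c f
    unfolding q_def T.scaleR by (simp add: L2_inner_simps power2_eq_square)
  have n2_scale: "n2 (c *\<^sub>R f) = c\<^sup>2 * n2 f" for c f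
    by (simp add: n2_def L2_inner_simps power2_eq_square)
  have normalize: "q f / n2 f \<le> s \<and> q f / n2 f \<in> q ` {f. n2 f = 1}" if "f \<noteq> 0" for f
  proof -
    have pos: "n2 f > 0" using L2_inner_bcontfun_pos[OF that] by (simp add: n2_def)
    let ?c = "1 / sqrt (n2 f)"
    have c2: "?c\<^sup>2 = 1 / n2 f" using pos by (simp add: power_divide)
    have "n2 (?c *\<^sub>R f) = 1" "q (?c *\<^sub>R f) = q f / n2 f"
      using pos unfolding q_scale n2_scale c2 by simp_all
    then have "q f / n2 f \<in> q ` {f. n2 f = 1}" by (metis (mono_tags, lifting) image_eqI mem_Collect_eq)
    then show ?thesis using bdd by (auto simp: s_def intro: cSup_upper)
  qed
  have q_le: "q f \<le> s * n2 f" for f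
  proof (cases "f = 0")
    case True
    then show ?thesis by (simp add: q_def n2_def L2_inner_def)
  next
    case False
    have "n2 f > 0" using L2_inner_bcontfun_pos[OF False] by (simp add: n2_def)
    then show ?thesis using normalize[OF False] by (simp add: field_simps)
  qed
  have "f0 \<noteq> 0" using f0 by (auto simp: L2_inner_def)
  have "n2 f0 > 0" using L2_inner_bcontfun_pos[OF \<open>f0 \<noteq> 0\<close>] by (simp add: n2_def)
  then have "t < q f0 / n2 f0" using f0 by (simp add: q_def n2_def field_simps)
  then have st: "t < s" using normalize[OF \<open>f0 \<noteq> 0\<close>] by linarith
  have nonempty: "q ` {f. n2 f = 1} \<noteq> {}" using normalize[OF \<open>f0 \<noteq> 0\<close>] by blast
  have "\<exists>f. n2 f = 1 \<and> s - 1 / real (Suc n) < q f" for n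
    using less_cSup_iff[OF nonempty bdd, of "s - 1 / real (Suc n)"] by (auto simp: s_def)
  then obtain f where f: "\<And>n. n2 (f n) = 1" "\<And>n. s - 1 / real (Suc n) < q (f n)" by metis
  \<comment> \<open>The supremum \<open>s\<close> of the quadratic form makes \<open>s - T\<^sub>G\<close> positive semidefinite, and Cauchy-Schwarz for it
    turns \<open>s - \<langle>T\<^sub>G f\<^sub>n, f\<^sub>n\<rangle> \<rightarrow> 0\<close> into \<open>(s - T\<^sub>G) f\<^sub>n \<rightarrow> 0\<close>.\<close>
  define h where "h n = s *\<^sub>R f n - kernel_op G (f n)" for n
  define K where "K = s + norm G"
  have h_small: "n2 (h n) \<le> K / real (Suc n)" for n
  proof -
    define B where "B u v = s * L2_inner u v - L2_inner (kernel_op G u) v"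
      for u v :: "unit_ivl \<Rightarrow>\<^sub>C real"
    have Bfh: "B (f n) (h n) = n2 (h n)"
      by (simp add: B_def n2_def h_def L2_inner_simps L2_intros algebra_simps)
    have "0 \<le> B (f n) (f n) + 2 * c * B (f n) (h n) + c\<^sup>2 * B (h n) (h n)" for c
    proof -
      have Tcomm: "L2_inner (kernel_op G (h n)) (f n) = L2_inner (kernel_op G (f n)) (h n)"
        using kernel_op_symmetric[OF G, of "h n" "f n"] by (simp add: L2_inner_commute)
      have "0 \<le> s * n2 (f n + c *\<^sub>R h n) - q (f n + c *\<^sub>R h n)" using q_le by simp
      also have "n2 (f n + c *\<^sub>R h n) = n2 (f n) + 2 * c * L2_inner (f n) (h n) + c\<^sup>2 * n2 (h n)"
        by (simp add: n2_def L2_inner_simps L2_intros L2_inner_commute[of "h n" "f n"]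
            power2_eq_square algebra_simps)
      also have "q (f n + c *\<^sub>R h n)
          = q (f n) + 2 * c * L2_inner (kernel_op G (f n)) (h n) + c\<^sup>2 * q (h n)"
        unfolding q_def T.add T.scaleR
        by (simp add: L2_inner_simps L2_intros Tcomm power2_eq_square algebra_simps)
      finally show ?thesis
        by (simp add: B_def n2_def q_def algebra_simps)
    qed
    then have "(B (f n) (h n))\<^sup>2 \<le> B (f n) (f n) * B (h n) (h n)"
      by (rule discriminant_nonpos)
    also have "\<dots> \<le> (1 / real (Suc n)) * (K * n2 (h n))"
    proof (rule mult_mono)
      show "B (f n) (f n) \<le> 1 / real (Suc n)"
        using f[of n] by (simp add: B_def n2_def q_def)
      show "B (h n) (h n) \<le> K * n2 (h n)"
        using kernel_op_quadratic_le[of G "h n"] by (simp add: B_def K_def n2_def algebra_simps)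
      show "0 \<le> B (h n) (h n)"
        using q_le[of "h n"] by (simp add: B_def n2_def q_def)
    qed simp
    finally have sq: "n2 (h n) * n2 (h n) \<le> (K / real (Suc n)) * n2 (h n)"
      unfolding Bfh by (simp add: power2_eq_square)
    show ?thesis
    proof (cases "n2 (h n) = 0")
      case True
      then show ?thesis using st t by (simp add: K_def)
    next
      case False
      then have "n2 (h n) > 0" using L2_inner_self_nonneg[of "h n"] by (simp add: n2_def less_le)
      then show ?thesis using mult_right_le_imp_le[OF sq] by blast
    qed
  qed
  have h0: "(\<lambda>n. L2_norm (h n)) \<longlonglongrightarrow> 0"
  proof -
    have "(\<lambda>n. K / real (Suc n)) \<longlonglongrightarrow> 0"
      using LIMSEQ_Suc[OF lim_const_over_n[of K]] .
    then have "(\<lambda>n. n2 (h n)) \<longlonglongrightarrow> 0"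
      by (rule Lim_null_comparison[rotated]) (use h_small in \<open>simp add: n2_def\<close>)
    then have "(\<lambda>n. sqrt (n2 (h n))) \<longlonglongrightarrow> sqrt 0" by (rule tendsto_real_sqrt)
    then show ?thesis by (simp add: L2_norm_def n2_def)
  qed
  have "L2_norm (f n) \<le> 1" for n using f(1)[of n] by (simp add: L2_norm_def n2_def)
  then obtain g r where r: "strict_mono (r :: nat \<Rightarrow> nat)"
    and g: "(\<lambda>n. kernel_op G (f (r n))) \<longlonglongrightarrow> g"
    using kernel_op_compact[of "\<lambda>n. apply_bcontfun (f n)" G, OF L2_bcontfun] by blast
  \<comment> \<open>One more application of the operator turns \<open>h\<close> into an expression
    in the convergent images only, and smallness in \<open>L2\<close> into smallness in the supremum
    norm.\<close>
  have "(\<lambda>n. kernel_op G (h (r n))) \<longlonglongrightarrow> 0"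
  proof (rule Lim_null_comparison)
    show "\<forall>\<^sub>F n in sequentially. norm (kernel_op G (h (r n))) \<le> norm G * L2_norm (h (r n))"
      by (intro always_eventually allI norm_kernel_op) simp
    show "(\<lambda>n. norm G * L2_norm (h (r n))) \<longlonglongrightarrow> 0"
      using tendsto_mult_left[OF LIMSEQ_subseq_LIMSEQ[OF h0 r], of "norm G"] by (simp add: comp_def)
  qed
  moreover have "(\<lambda>n. kernel_op G (h (r n))) \<longlonglongrightarrow> s *\<^sub>R g - kernel_op G g"
    unfolding h_def T.diff T.scaleR by (intro tendsto_intros g T.tendsto)
  ultimately have "s *\<^sub>R g - kernel_op G g = 0" by (metis LIMSEQ_unique)
  then have eig: "g \<in> eigenspace G s" by (simp add: eigenspace_iff)
  \<comment> \<open>This excludes \<open>g = 0\<close>: for unit \<open>f\<close> the form is at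
    most the norm of the image, and \<open>s\<close> is positive.\<close>
  have "s \<le> norm g"
  proof (rule LIMSEQ_le)
    show "(\<lambda>n. norm (kernel_op G (f (r n)))) \<longlonglongrightarrow> norm g" by (intro tendsto_norm g)
    have "(\<lambda>n. 1 / real (Suc n)) \<longlonglongrightarrow> 0"
      using LIMSEQ_Suc[OF lim_const_over_n[of 1]] .
    then have "(\<lambda>n. s - 1 / real (Suc (r n))) \<longlonglongrightarrow> s - 0"
      by (intro tendsto_diff tendsto_const) (use LIMSEQ_subseq_LIMSEQ[OF _ r] in \<open>force simp: comp_def\<close>)
    then show "(\<lambda>n. s - 1 / real (Suc (r n))) \<longlonglongrightarrow> s" by simp
    have "s - 1 / real (Suc (r n)) \<le> norm (kernel_op G (f (r n)))" for n
    proof -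
      have "q (f (r n)) \<le> L2_norm (kernel_op G (f (r n))) * L2_norm (f (r n))"
        using L2_Cauchy_Schwarz[of "kernel_op G (f (r n))" "f (r n)"] by (simp add: q_def)
      also have "\<dots> = L2_norm (kernel_op G (f (r n)))"
        using f(1)[of "r n"] by (simp add: L2_norm_def n2_def)
      also have "\<dots> \<le> norm (kernel_op G (f (r n)))" by (rule L2_norm_le_norm)
      finally show ?thesis using f(2)[of "r n"] by simp
    qed
    then show "\<exists>N. \<forall>n\<ge>N. s - 1 / real (Suc (r n)) \<le> norm (kernel_op G (f (r n)))" by blast
  qed
  then have "g \<noteq> 0" using st t by auto
  then show ?thesis using st eig by blast
qed

section \<open>Deflation and the min-max principle for eigenvalue counts\<close>

definition tensor_kernel :: "(unit_ivl \<Rightarrow>\<^sub>C real) \<Rightarrow> kernel" where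
  "tensor_kernel e = Bcontfun (\<lambda>p. e (fst p) * e (snd p))"

lemma apply_tensor_kernel: "apply_bcontfun (tensor_kernel e) (x, y) = e x * e y"
proof -
  have "continuous_on UNIV (\<lambda>p. e (fst p) * e (snd p))"
    by (intro continuous_intros continuous_on_compose2[OF continuous_on_apply_bcontfun]) auto
  then show ?thesis
    by (simp add: tensor_kernel_def bcontfun_unit_square Bcontfun_inverse)
qed

lemma kernel_op_tensor_kernel:
  assumes "h \<in> L2"
  shows "kernel_op (tensor_kernel e) h = L2_inner h e *\<^sub>R e"
proof (rule kernel_op_eqI[OF assms])
  fix x
  have "int_op (tensor_kernel e) h x = (\<integral>y. e x * (h y * e y) \<partial>leb01)"
    by (simp add: int_op_def apply_tensor_kernel mult_ac)
  then show "int_op (tensor_kernel e) h x = apply_bcontfun (L2_inner h e *\<^sub>R e) x"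
    by (simp add: L2_inner_def)
qed

text \<open>Lower half of the min-max principle. With too few eigenfunctions above \<open>t\<close>,
  some nontrivial combination is orthogonal to all of them and still has a large quadratic form,
  which produces a further eigenfunction. The strict inequality contains the linear independence of
  \<open>v\<close>, since it fails for the zero function.\<close>

lemma card_le_eigenvalue_count:
  fixes v :: "'i \<Rightarrow> (unit_ivl \<Rightarrow>\<^sub>C real)"
  assumes G: "symmetric_kernel G" and t: "t > 0" and A: "finite A"
    and v: "\<And>c f. \<exists>j\<in>A. c j \<noteq> 0 \<Longrightarrow> f = (\<Sum>j\<in>A. c j *\<^sub>R v j) \<Longrightarrow>
      t * L2_inner (apply_bcontfun f) (apply_bcontfun f)
        < L2_inner (apply_bcontfun (kernel_op G (apply_bcontfun f))) (apply_bcontfun f)"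
  shows "card A \<le> eigenvalue_count G t"
proof (rule ccontr)
  assume "\<not> ?thesis"
  moreover obtain E :: "(unit_ivl \<Rightarrow>\<^sub>C real) set" where E: "finite E"
    "orthonormal_family E apply_bcontfun"
    "\<forall>e\<in>E. \<exists>\<mu>\<ge>t. e \<in> eigenspace G \<mu>"
    and complete: "\<And>\<mu> f. \<mu> \<ge> t \<Longrightarrow> f \<in> eigenspace G \<mu> \<Longrightarrow>
      (\<forall>e\<in>E. L2_inner (apply_bcontfun f) (apply_bcontfun e) = 0) \<Longrightarrow> f = 0"
    and card: "card E = eigenvalue_count G t"
    using ex_complete_eigensystem[OF G t] by (elim exE conjE) (rule that, assumption+, blast, assumption)
  ultimately have "card E < card A" by simp
  from homogeneous_system_nontrivial_solution[OF E(1) A this,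
      of "\<lambda>e j. L2_inner (apply_bcontfun (v j)) (apply_bcontfun e)"]
  obtain c where c: "\<exists>j\<in>A. c j \<noteq> 0"
    "\<forall>e\<in>E. (\<Sum>j\<in>A. L2_inner (apply_bcontfun (v j)) (apply_bcontfun e) * c j) = 0"
    by (elim exE conjE)
  define f where "f = (\<Sum>j\<in>A. c j *\<^sub>R v j)"
  have f_perp: "L2_inner f (apply_bcontfun e) = 0" if "e \<in> E" for e
  proof -
    interpret bounded_linear "\<lambda>h. L2_inner (apply_bcontfun h) (apply_bcontfun e)"
      by (rule bounded_linear_L2_inner) simp
    have "L2_inner f (apply_bcontfun e)
        = (\<Sum>j\<in>A. L2_inner (apply_bcontfun (v j)) (apply_bcontfun e) * c j)"
      unfolding f_def sum scaleR by (simp add: mult.commute)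
    then show ?thesis using c(2) that by simp
  qed
  obtain \<mu> where \<mu>: "\<And>e. e \<in> E \<Longrightarrow> \<mu> e \<ge> t" "\<And>e. e \<in> E \<Longrightarrow> e \<in> eigenspace G (\<mu> e)"
    using E(3) by metis
  \<comment> \<open>Deflation: \<open>G'\<close> annihilates \<open>E\<close> and agrees with \<open>G\<close> on its orthogonal complement, so its top
    eigenfunction is a missing eigenfunction of \<open>G\<close>.\<close>
  define G' where "G' = G - (\<Sum>e\<in>E. \<mu> e *\<^sub>R tensor_kernel e)"
  have G'_op: "kernel_op G' h = kernel_op G h - (\<Sum>e\<in>E. (\<mu> e * L2_inner h (apply_bcontfun e)) *\<^sub>R e)"
    if "h \<in> L2" for h
  proof -
    interpret bounded_linear "\<lambda>G. kernel_op G h" by (rule bounded_linear_kernel_op_kernel[OF that])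
    show ?thesis
      unfolding G'_def diff sum scaleR kernel_op_tensor_kernel[OF that] scaleR_scaleR ..
  qed
  have apply_sum: "apply_bcontfun (\<Sum>e\<in>E. \<mu> e *\<^sub>R tensor_kernel e) p = (\<Sum>e\<in>E. \<mu> e * tensor_kernel e p)" for p
    by (induction E rule: infinite_finite_induct) auto
  have G': "symmetric_kernel G'"
    using G by (simp add: symmetric_kernel_def G'_def apply_sum apply_tensor_kernel mult_ac)
  have perp_eq: "kernel_op G' (apply_bcontfun h) = kernel_op G h"
    if "\<forall>e\<in>E. L2_inner h (apply_bcontfun e) = 0" for h :: "unit_ivl \<Rightarrow>\<^sub>C real"
    using that by (simp add: G'_op)
  have "t * L2_inner f f < L2_inner (kernel_op G' f) f"
    using v[OF c(1) f_def] perp_eq[of f] f_perp by simp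
  then obtain s g where s: "s > t" and g: "g \<in> eigenspace G' s" "g \<noteq> 0"
    using ex_eigenvalue_ge[OF G' less_imp_le[OF t]] by blast
  \<comment> \<open>The deflated operator maps \<open>e\<close> to 0, while \<open>g\<close> belongs
    to the nonzero eigenvalue \<open>s\<close>; by symmetry they are orthogonal.\<close>
  have g_perp: "L2_inner g (apply_bcontfun e) = 0" if e: "e \<in> E" for e
  proof -
    have "(\<Sum>e'\<in>E. (\<mu> e' * L2_inner (apply_bcontfun e) (apply_bcontfun e')) *\<^sub>R e') = \<mu> e *\<^sub>R e"
    proof -
      have "(\<Sum>e'\<in>E. (\<mu> e' * L2_inner (apply_bcontfun e) (apply_bcontfun e')) *\<^sub>R e')
          = (\<Sum>e'\<in>E. if e' = e then \<mu> e *\<^sub>R e else 0)"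
        using orthonormal_familyD(2)[OF E(2) e] by (intro sum.cong) auto
      then show ?thesis using E(1) e by simp
    qed
    then have "kernel_op G' e = 0"
      using \<mu>(2)[OF e] by (simp add: G'_op eigenspace_iff)
    then have "s * L2_inner g (apply_bcontfun e) = 0"
      using kernel_op_symmetric[OF G', of g e] g(1)
      by (simp add: eigenspace_iff L2_inner_scale_left) (simp add: L2_inner_def)
    then show ?thesis using s t by simp
  qed
  then have "g \<in> eigenspace G s"
    using g(1) perp_eq[of g] by (simp add: eigenspace_iff)
  then show False using complete[of s g] g_perp s g(2) by simp
qed

text \<open>Upper half of the min-max principle: the span of the eigenfunctions above
  \<open>t\<close> has more dimensions than there are constraints, and the form is at least
  \<open>t\<close> on it.\<close>

lemma ex_orthogonal_above:
  fixes p :: "'i \<Rightarrow> unit_ivl \<Rightarrow> real"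
  assumes G: "symmetric_kernel G" and t: "t > 0" and I: "finite I" "card I < eigenvalue_count G t"
    and p: "\<And>i. i \<in> I \<Longrightarrow> p i \<in> L2"
  shows "\<exists>f :: unit_ivl \<Rightarrow>\<^sub>C real. f \<noteq> 0 \<and> (\<forall>i\<in>I. L2_inner (apply_bcontfun f) (p i) = 0) \<and>
    t * L2_inner (apply_bcontfun f) (apply_bcontfun f)
      \<le> L2_inner (apply_bcontfun (kernel_op G (apply_bcontfun f))) (apply_bcontfun f)"
proof -
  obtain E :: "(unit_ivl \<Rightarrow>\<^sub>C real) set" where E: "finite E"
    "orthonormal_family E apply_bcontfun"
    "\<forall>e\<in>E. \<exists>\<mu>\<ge>t. e \<in> eigenspace G \<mu>"
    and card: "card E = eigenvalue_count G t"
    using ex_complete_eigensystem[OF G t] by (elim exE conjE) (rule that)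
  obtain \<mu> where \<mu>: "\<And>e. e \<in> E \<Longrightarrow> \<mu> e \<ge> t" "\<And>e. e \<in> E \<Longrightarrow> e \<in> eigenspace G (\<mu> e)"
    using E(3) by metis
  from homogeneous_system_nontrivial_solution[OF I(1) E(1) I(2)[folded card],
      of "\<lambda>i e. L2_inner (apply_bcontfun e) (p i)"]
  obtain c where c: "\<exists>e\<in>E. c e \<noteq> 0"
    "\<forall>i\<in>I. (\<Sum>e\<in>E. L2_inner (apply_bcontfun e) (p i) * c e) = 0"
    by (elim exE conjE)
  define f where "f = (\<Sum>e\<in>E. c e *\<^sub>R e)"
  have f: "apply_bcontfun f = (\<lambda>x. \<Sum>e\<in>E. c e * e x)"
    by (auto simp: f_def apply_bcontfun_sum)
  have "L2_inner f (p i) = 0" if "i \<in> I" for i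
    using c(2) that p[OF that] by (simp add: f L2_inner_simps L2_intros mult.commute)
  moreover have ff: "L2_inner f f = (\<Sum>e\<in>E. c e * c e)"
    unfolding f by (rule L2_inner_lincomb[OF E(2,1)])
  have "kernel_op G f = (\<Sum>e\<in>E. (\<mu> e * c e) *\<^sub>R e)"
  proof -
    interpret bounded_linear "\<lambda>f. kernel_op G (apply_bcontfun f)" by (rule bounded_linear_kernel_op)
    show ?thesis
      unfolding f_def sum scaleR using \<mu>(2) by (intro sum.cong) (auto simp: eigenspace_iff mult.commute)
  qed
  then have Tf: "apply_bcontfun (kernel_op G f) = (\<lambda>x. \<Sum>e\<in>E. (\<mu> e * c e) * e x)"
    by (auto simp: apply_bcontfun_sum)
  have "L2_inner (kernel_op G f) f = (\<Sum>e\<in>E. \<mu> e * c e * c e)"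
    unfolding f[symmetric] Tf unfolding f by (rule L2_inner_lincomb[OF E(2,1)])
  moreover have "t * (\<Sum>e\<in>E. c e * c e) \<le> (\<Sum>e\<in>E. \<mu> e * c e * c e)"
    unfolding sum_distrib_left mult.assoc using \<mu>(1) by (intro sum_mono mult_right_mono) auto
  moreover have "f \<noteq> 0"
  proof
    assume "f = 0"
    then have "L2_inner f f = 0" by (simp add: L2_inner_def)
    then show False using c(1) E(1) unfolding ff by (simp add: sum_nonneg_eq_0_iff)
  qed
  ultimately show ?thesis using ff by metis
qed


subsection \<open>The \<open>k\<close>-th eigenvalue\<close>

lemma eigenvalue_le_norm:
  assumes "is_eigenvalue G \<mu>"
  shows "\<mu> \<le> norm G"
proof -
  obtain f where f: "f \<in> eigenspace G \<mu>" "f \<noteq> 0" using assms by (auto simp: is_eigenvalue_def)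
  then have "\<mu> * L2_inner f f \<le> norm G * L2_inner f f"
    using kernel_op_quadratic_le[of G f] by (simp add: eigenspace_iff L2_inner_scale_left)
  then show ?thesis using L2_inner_bcontfun_pos[OF f(2)] mult_right_le_imp_le by blast
qed

lemma bdd_above_kth_eigenvalue:
  "bdd_above (insert 0 {\<mu>. 0 < \<mu> \<and> is_eigenvalue G \<mu> \<and> k \<le> eigenvalue_count G \<mu>})"
  using eigenvalue_le_norm by (intro bdd_aboveI[of _ "norm G"]) auto

lemma kth_eigenvalue_nonneg: "0 \<le> kth_eigenvalue G k"
  unfolding kth_eigenvalue_def by (intro cSup_upper bdd_above_kth_eigenvalue) auto

lemma kth_eigenvalue_antimono: "k \<le> l \<Longrightarrow> kth_eigenvalue G l \<le> kth_eigenvalue G k"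
  unfolding kth_eigenvalue_def by (intro cSup_subset_mono bdd_above_kth_eigenvalue) auto

text \<open>The supremum in \<open>kth_eigenvalue\<close> ranges over eigenvalues only, and
  \<open>t\<close> need not be one. Raising \<open>t\<close> to the smallest eigenvalue above it
  leaves the count unchanged.\<close>

lemma kth_eigenvalue_ge:
  assumes G: "symmetric_kernel G" and t: "t > 0" and k: "k \<ge> 1" "k \<le> eigenvalue_count G t"
  shows "t \<le> kth_eigenvalue G k"
proof -
  define M where "M = {\<mu>. t \<le> \<mu> \<and> is_eigenvalue G \<mu>}"
  have "finite M" using ex_complete_eigensystem[OF G t] unfolding M_def by (elim exE conjE)
  moreover have "M \<noteq> {}"
    using k unfolding eigenvalue_count_def M_def[symmetric] by auto
  ultimately have min: "Min M \<in> M" "\<And>\<mu>. \<mu> \<in> M \<Longrightarrow> Min M \<le> \<mu>" by auto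
  then have "{\<mu>. Min M \<le> \<mu> \<and> is_eigenvalue G \<mu>} = M"
    by (force simp: M_def)
  then have "eigenvalue_count G (Min M) = eigenvalue_count G t"
    by (simp add: eigenvalue_count_def M_def)
  then have "Min M \<le> kth_eigenvalue G k"
    unfolding kth_eigenvalue_def using min(1) t k
    by (intro cSup_upper bdd_above_kth_eigenvalue) (auto simp: M_def)
  then show ?thesis using min(1) by (simp add: M_def)
qed


subsection \<open>Sums in \<open>L\<^sub>2[0,1]\<close>\<close>

lemma has_L2_sum_inner:
  assumes "has_L2_sum g A s" "h \<in> L2"
  shows "((\<lambda>j. L2_inner (g j) h) has_sum L2_inner s h) A"
proof -
  have s: "s \<in> L2" and g: "\<And>j. j \<in> A \<Longrightarrow> g j \<in> L2"
    and lim: "((\<lambda>F. L2_norm (\<lambda>x. s x - (\<Sum>j\<in>F. g j x))) \<longlongrightarrow> 0) (finite_subsets_at_top A)"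
    using assms by (auto simp: has_L2_sum_def)
  have "((\<lambda>F. (\<Sum>j\<in>F. L2_inner (g j) h) - L2_inner s h) \<longlongrightarrow> 0) (finite_subsets_at_top A)"
  proof (rule Lim_null_comparison)
    show "\<forall>\<^sub>F F in finite_subsets_at_top A. norm ((\<Sum>j\<in>F. L2_inner (g j) h) - L2_inner s h)
        \<le> L2_norm (\<lambda>x. s x - (\<Sum>j\<in>F. g j x)) * L2_norm h"
    proof (rule eventually_finite_subsets_at_top_weakI)
      fix F assume F: "finite F" "F \<subseteq> A"
      then have gF: "\<And>j. j \<in> F \<Longrightarrow> g j \<in> L2" using g by blast
      have "L2_inner (\<lambda>x. s x - (\<Sum>j\<in>F. g j x)) h = L2_inner s h - (\<Sum>j\<in>F. L2_inner (g j) h)"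
        using s gF assms(2) by (simp add: L2_inner_simps L2_intros)
      moreover have "\<bar>L2_inner (\<lambda>x. s x - (\<Sum>j\<in>F. g j x)) h\<bar>
          \<le> L2_norm (\<lambda>x. s x - (\<Sum>j\<in>F. g j x)) * L2_norm h"
        using s gF assms(2) by (intro L2_Cauchy_Schwarz L2_intros) auto
      ultimately show "norm ((\<Sum>j\<in>F. L2_inner (g j) h) - L2_inner s h)
          \<le> L2_norm (\<lambda>x. s x - (\<Sum>j\<in>F. g j x)) * L2_norm h"
        by (simp add: abs_minus_commute)
    qed
    show "((\<lambda>F. L2_norm (\<lambda>x. s x - (\<Sum>j\<in>F. g j x)) * L2_norm h) \<longlongrightarrow> 0) (finite_subsets_at_top A)"
      using tendsto_mult_right[OF lim, of "L2_norm h"] by simp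
  qed
  then show ?thesis unfolding has_sum_def by (simp add: LIM_zero_iff)
qed

text \<open>Meant for the resolvent series in \<open>C[0,1]\<close>: its tails are controlled as
  finite sums, through square sums of coefficients, while absolute convergence in the supremum norm
  is not at hand.\<close>

lemma summable_on_Cauchy_criterion:
  fixes f :: "'i \<Rightarrow> 'a::{real_normed_vector, complete_space}"
  assumes "\<And>e. e > 0 \<Longrightarrow> \<exists>F0. finite F0 \<and> F0 \<subseteq> A \<and>
    (\<forall>F. finite F \<and> F \<subseteq> A \<and> F \<inter> F0 = {} \<longrightarrow> norm (sum f F) < e)"
  shows "f summable_on A"
proof -
  have "\<exists>P. eventually P (finite_subsets_at_top A) \<and>
      (\<forall>F F'. P F \<and> P F' \<longrightarrow> dist (sum f F) (sum f F') < e)" if e: "e > 0" for e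
  proof -
    from assms[of "e / 2"] e obtain F0 where F0: "finite F0" "F0 \<subseteq> A"
      and tail: "\<forall>F. finite F \<and> F \<subseteq> A \<and> F \<inter> F0 = {} \<longrightarrow> norm (sum f F) < e / 2"
      by (elim exE conjE meta_impE) simp_all
    define P where "P F \<longleftrightarrow> finite F \<and> F0 \<subseteq> F \<and> F \<subseteq> A" for F
    have "eventually P (finite_subsets_at_top A)"
      unfolding eventually_finite_subsets_at_top P_def using F0 by blast
    moreover have "dist (sum f F) (sum f F') < e" if "P F" "P F'" for F F'
    proof -
      have split: "dist (sum f F) (sum f F0) < e / 2" if "P F" for F
      proof -
        have "sum f F - sum f F0 = sum f (F - F0)"
          using that F0 by (intro sum_diff[symmetric]) (auto simp: P_def)
        moreover have "norm (sum f (F - F0)) < e / 2"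
          using that by (intro tail[rule_format]) (auto simp: P_def)
        ultimately show ?thesis by (simp add: dist_norm)
      qed
      show ?thesis using dist_triangle_half_l[OF split[OF that(1)] split[OF that(2)]] .
    qed
    ultimately show ?thesis by blast
  qed
  then have "cauchy_filter (filtermap (sum f) (finite_subsets_at_top A))"
    by (simp add: cauchy_filter_metric_filtermap)
  then obtain L where "(sum f \<longlongrightarrow> L) (finite_subsets_at_top A)"
    using cauchy_filter_convergent by (force simp: convergent_filter.simps filterlim_def)
  then show ?thesis
    using summable_on_def has_sum_def by blast
qed


subsection \<open>A simple positive eigenvalue\<close>

locale simple_eigenvalue =
  fixes \<Gamma> :: kernel and J :: "int set" and lam :: "int \<Rightarrow> real"
    and \<phi> :: "int \<Rightarrow> unit_ivl \<Rightarrow> real" and k :: nat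
  assumes sym: "symmetric_kernel \<Gamma>"
    and basis: "eigenbasis \<Gamma> J lam \<phi>"
    and k: "k \<ge> 1"
    and lam_pos: "lam (int k) > 0"
    and simple: "multiplicity_of \<Gamma> (lam (int k)) = 1"
begin

lemma onf: "orthonormal_family J \<phi>"
  using basis by (simp add: eigenbasis_def orthonormal_basis_def orthonormal_family_def)

lemmas \<phi>_L2 = orthonormal_familyD(1)[OF onf]

lemma pos_in_J: "j \<ge> 1 \<Longrightarrow> j \<in> J"
  using basis by (auto simp: eigenbasis_def)

lemma k_in_J: "int k \<in> J"
  using k by (intro pos_in_J) simp

lemma lam_eq: "j \<in> J \<Longrightarrow> lam j = (if j \<ge> 1 then kth_eigenvalue \<Gamma> (nat j) else 0)"
  using basis by (simp add: eigenbasis_def)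

lemma lam_nonneg: "j \<in> J \<Longrightarrow> 0 \<le> lam j"
  by (simp add: lam_eq kth_eigenvalue_nonneg)

lemma lam_antimono: "1 \<le> i \<Longrightarrow> i \<le> j \<Longrightarrow> lam j \<le> lam i"
  by (simp add: lam_eq pos_in_J kth_eigenvalue_antimono nat_mono)

lemma basis_sum: "f \<in> L2 \<Longrightarrow> has_L2_sum (\<lambda>j x. L2_inner f (\<phi> j) * \<phi> j x) J f"
  using basis by (auto simp: eigenbasis_def orthonormal_basis_def)

lemma AE_kernel_op_\<phi>:
  assumes "j \<in> J"
  shows "AE x in leb01. apply_bcontfun (kernel_op \<Gamma> (\<phi> j)) x = lam j * \<phi> j x"
  using basis assms unfolding eigenbasis_def apply_kernel_op[OF \<phi>_L2[OF assms]] by blast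

text \<open>The basis function as an element of \<open>C[0,1]\<close>. For \<open>lam j = 0\<close>
  the function \<open>\<phi> j\<close> may be discontinuous, and then nothing is claimed about
  \<open>\<psi> j\<close>.\<close>

definition \<psi> :: "int \<Rightarrow> (unit_ivl \<Rightarrow>\<^sub>C real)" where
  "\<psi> j = Bcontfun (\<phi> j)"

lemma continuous_\<phi>: "j \<in> J \<Longrightarrow> lam j \<noteq> 0 \<Longrightarrow> continuous_on UNIV (\<phi> j)"
  using basis by (auto simp: eigenbasis_def)

lemma apply_\<psi>: "j \<in> J \<Longrightarrow> lam j \<noteq> 0 \<Longrightarrow> apply_bcontfun (\<psi> j) = \<phi> j"
  using continuous_\<phi> by (simp add: \<psi>_def bcontfun_unit_ivl Bcontfun_inverse)

lemma apply_\<psi>_k [simp]: "apply_bcontfun (\<psi> (int k)) = \<phi> (int k)"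
  using lam_pos by (intro apply_\<psi> k_in_J) simp

lemma \<psi>_eigenspace:
  assumes "j \<in> J" "lam j \<noteq> 0"
  shows "\<psi> j \<in> eigenspace \<Gamma> (lam j)"
proof -
  have "apply_bcontfun (kernel_op \<Gamma> (\<phi> j)) x = lam j * \<phi> j x" for x
    by (rule AE_leb01_continuous_eq[OF AE_kernel_op_\<phi>[OF assms(1)]])
      (auto intro!: continuous_intros continuous_\<phi>[OF assms])
  then show ?thesis
    unfolding eigenspace_iff using assms by (intro bcontfun_eqI) (simp add: apply_\<psi>)
qed

lemma inner_kernel_op_\<phi>:
  assumes "f \<in> L2" "j \<in> J"
  shows "L2_inner (kernel_op \<Gamma> f) (\<phi> j) = lam j * L2_inner f (\<phi> j)"
proof -
  have "L2_inner (kernel_op \<Gamma> f) (\<phi> j) = L2_inner (kernel_op \<Gamma> (\<phi> j)) f"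
    using kernel_op_symmetric[OF sym assms(1) \<phi>_L2[OF assms(2)]] by (simp add: L2_inner_commute)
  also have "\<dots> = L2_inner (\<lambda>x. lam j * \<phi> j x) f"
    using AE_kernel_op_\<phi>[OF assms(2)] assms \<phi>_L2 by (intro L2_inner_cong_AE L2_intros) auto
  finally show ?thesis by (simp add: L2_inner_scale_left L2_inner_commute)
qed

text \<open>A one-dimensional eigenspace cannot contain two orthonormal functions. Hence no
  denominator \<open>lam (int k) - lam j\<close> vanishes.\<close>

lemma lam_neq:
  assumes "j \<in> J" "j \<noteq> int k"
  shows "lam j \<noteq> lam (int k)"
proof
  assume eq: "lam j = lam (int k)"
  then have nz: "lam j \<noteq> 0" using lam_pos by simp
  let ?V = "eigenspace \<Gamma> (lam (int k))"
  obtain B where B: "?V \<subseteq> span B" "card B = dim ?V"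
    using basis_exists[of ?V] by metis
  then have "card B = 1" using simple by (simp add: multiplicity_of_def)
  then obtain b where "B = {b}" using card_1_singletonE by blast
  then have range: "?V \<subseteq> range (\<lambda>c. c *\<^sub>R b)" using B(1) by (simp add: span_singleton)
  have "\<psi> j \<in> ?V" "\<psi> (int k) \<in> ?V"
    using \<psi>_eigenspace[OF assms(1) nz] \<psi>_eigenspace[OF k_in_J] lam_pos eq by auto
  then obtain c d where cd: "\<psi> j = c *\<^sub>R b" "\<psi> (int k) = d *\<^sub>R b"
    using range by (meson imageE subsetD)
  have b: "\<phi> j = (\<lambda>x. c * b x)" "\<phi> (int k) = (\<lambda>x. d * b x)"
    using apply_\<psi>[OF assms(1) nz] apply_\<psi>_k unfolding cd by auto
  have "L2_inner (\<phi> j) (\<phi> (int k)) = 0" "L2_inner (\<phi> j) (\<phi> j) = 1"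
    "L2_inner (\<phi> (int k)) (\<phi> (int k)) = 1"
    using orthonormal_familyD(2)[OF onf] assms k_in_J by auto
  then show False unfolding b by (auto simp: L2_inner_scale_left L2_inner_scale_right)
qed

text \<open>A bound uniform over the infinite set \<open>J\<close> reduces to a finite minimum:
  apart from the indices below \<open>k\<close>, every eigenvalue is at most
  \<open>lam (int k + 1)\<close>, including the zeros carried by nonpositive indices.\<close>

lemma spectral_gap: "\<exists>\<delta>>0. \<forall>j\<in>J - {int k}. \<delta> \<le> \<bar>lam (int k) - lam j\<bar>"
proof -
  define D where "D = insert (lam (int k) - lam (int k + 1)) ((\<lambda>j. lam j - lam (int k)) ` {1..<int k})"
  have D: "finite D" "D \<noteq> {}" by (auto simp: D_def)
  have "lam (int k + 1) < lam (int k)"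
    using lam_antimono[of "int k" "int k + 1"] lam_neq[OF pos_in_J, of "int k + 1"] k by simp
  moreover have "lam (int k) < lam j" if "j \<in> {1..<int k}" for j
    using that lam_antimono[of j "int k"] lam_neq[OF pos_in_J, of j] by simp
  ultimately have "0 < d" if "d \<in> D" for d
    using that by (auto simp: D_def)
  then have "0 < Min D" using D by simp
  moreover have "Min D \<le> \<bar>lam (int k) - lam j\<bar>" if j: "j \<in> J - {int k}" for j
  proof (cases "j \<in> {1..<int k}")
    case True
    then have "Min D \<le> lam j - lam (int k)" using D by (intro Min_le) (auto simp: D_def)
    then show ?thesis by simp
  next
    case False
    have "lam j \<le> lam (int k + 1)"
    proof (cases "j \<ge> 1")
      case True
      then show ?thesis using False j by (intro lam_antimono) auto
    next
      case False
      then show ?thesis using j lam_nonneg[OF pos_in_J, of "int k + 1"] by (simp add: lam_eq)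
    qed
    moreover have "Min D \<le> lam (int k) - lam (int k + 1)" using D by (intro Min_le) (auto simp: D_def)
    ultimately show ?thesis by simp
  qed
  ultimately show ?thesis by blast
qed

text \<open>Expanding one of the two copies of \<open>f\<close> in the basis writes the form as the
  sum of \<open>lam j * (L2_inner f (\<phi> j))\<^sup>2\<close>. Terms with \<open>lam j\<close>
  above \<open>lam (int k)\<close> drop out, and Bessel bounds the rest.\<close>

lemma quadratic_le_on_complement:
  assumes f: "f \<in> L2" and perp: "\<And>i. i \<in> {1..<int k} \<Longrightarrow> L2_inner f (\<phi> i) = 0"
  shows "L2_inner (kernel_op \<Gamma> f) f \<le> lam (int k) * L2_inner f f"
proof -
  have "((\<lambda>j. L2_inner (\<lambda>x. L2_inner f (\<phi> j) * \<phi> j x) (kernel_op \<Gamma> f))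
      has_sum L2_inner f (kernel_op \<Gamma> f)) J"
    by (rule has_L2_sum_inner[OF basis_sum[OF f]]) simp
  then have "((\<lambda>F. \<Sum>j\<in>F. L2_inner (\<lambda>x. L2_inner f (\<phi> j) * \<phi> j x) (kernel_op \<Gamma> f))
      \<longlongrightarrow> L2_inner f (kernel_op \<Gamma> f)) (finite_subsets_at_top J)"
    by (simp add: has_sum_def)
  moreover have "\<forall>\<^sub>F F in finite_subsets_at_top J.
      (\<Sum>j\<in>F. L2_inner (\<lambda>x. L2_inner f (\<phi> j) * \<phi> j x) (kernel_op \<Gamma> f)) \<le> lam (int k) * L2_inner f f"
  proof (rule eventually_finite_subsets_at_top_weakI)
    fix F assume F: "finite F" "F \<subseteq> J"
    have "(\<Sum>j\<in>F. L2_inner (\<lambda>x. L2_inner f (\<phi> j) * \<phi> j x) (kernel_op \<Gamma> f))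
        \<le> (\<Sum>j\<in>F. lam (int k) * (L2_inner f (\<phi> j))\<^sup>2)"
    proof (rule sum_mono)
      fix j assume "j \<in> F"
      then have j: "j \<in> J" using F by blast
      have "L2_inner (\<lambda>x. L2_inner f (\<phi> j) * \<phi> j x) (kernel_op \<Gamma> f) = lam j * (L2_inner f (\<phi> j))\<^sup>2"
        using inner_kernel_op_\<phi>[OF f j]
        by (simp add: L2_inner_scale_left L2_inner_commute[of "\<phi> j" "kernel_op \<Gamma> f"] power2_eq_square)
      moreover have "lam j \<le> lam (int k)" if "j \<notin> {1..<int k}"
        using that j lam_antimono[of "int k" j] lam_pos k by (cases "j \<ge> 1") (auto simp: lam_eq)
      ultimately show "L2_inner (\<lambda>x. L2_inner f (\<phi> j) * \<phi> j x) (kernel_op \<Gamma> f)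
          \<le> lam (int k) * (L2_inner f (\<phi> j))\<^sup>2"
        using perp[of j] by (cases "j \<in> {1..<int k}") (auto intro: mult_right_mono)
    qed
    also have "\<dots> = lam (int k) * (\<Sum>j\<in>F. (L2_inner f (\<phi> j))\<^sup>2)"
      by (rule sum_distrib_left[symmetric])
    also have "\<dots> \<le> lam (int k) * L2_inner f f"
      using lam_pos F f by (intro mult_left_mono L2_Bessel orthonormal_family_subset[OF onf]) auto
    finally show "(\<Sum>j\<in>F. L2_inner (\<lambda>x. L2_inner f (\<phi> j) * \<phi> j x) (kernel_op \<Gamma> f))
        \<le> lam (int k) * L2_inner f f" .
  qed
  ultimately have "L2_inner f (kernel_op \<Gamma> f) \<le> lam (int k) * L2_inner f f"
    by (rule tendsto_upperbound) simp
  then show ?thesis by (simp add: L2_inner_commute)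
qed

text \<open>If \<open>G\<close> has at least \<open>k\<close> eigenvalues from \<mu> upwards, a
  nonzero combination of their eigenfunctions meets the \<open>k - 1\<close> conditions of being
  orthogonal to the earlier \<open>\<phi> i\<close>. There the form of \<open>G\<close> is at least
  \<mu> and that of \<Gamma> at most \<open>lam (int k)\<close>, relative to the squared
  norm.\<close>

lemma kth_eigenvalue_perturbation_upper:
  assumes G: "symmetric_kernel G"
  shows "kth_eigenvalue G k \<le> lam (int k) + norm (G - \<Gamma>)"
  unfolding kth_eigenvalue_def
proof (rule cSup_least)
  fix \<mu> assume "\<mu> \<in> insert 0 {\<mu>. 0 < \<mu> \<and> is_eigenvalue G \<mu> \<and> k \<le> eigenvalue_count G \<mu>}"
  moreover have "\<mu> \<le> lam (int k) + norm (G - \<Gamma>)" if \<mu>: "0 < \<mu>" "k \<le> eigenvalue_count G \<mu>"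
  proof -
    have "card {1..<int k} < eigenvalue_count G \<mu>" using \<mu>(2) k by simp
    then obtain f :: "unit_ivl \<Rightarrow>\<^sub>C real" where f: "f \<noteq> 0"
      "\<forall>i\<in>{1..<int k}. L2_inner (apply_bcontfun f) (\<phi> i) = 0"
      "\<mu> * L2_inner f f \<le> L2_inner (kernel_op G f) f"
      using ex_orthogonal_above[OF G \<mu>(1), of "{1..<int k}" \<phi>] \<phi>_L2 pos_in_J by auto
    have "\<mu> * L2_inner f f \<le> L2_inner (kernel_op \<Gamma> f) f + L2_inner (kernel_op (G - \<Gamma>) f) f"
      using f(3) by (simp add: kernel_op_diff_kernel L2_inner_simps)
    also have "\<dots> \<le> lam (int k) * L2_inner f f + norm (G - \<Gamma>) * L2_inner f f"
      using kernel_op_quadratic_le[of "G - \<Gamma>" f] f(2)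
      by (intro add_mono quadratic_le_on_complement) auto
    finally have "\<mu> * L2_inner f f \<le> (lam (int k) + norm (G - \<Gamma>)) * L2_inner f f"
      by (simp add: distrib_right)
    then show ?thesis using L2_inner_bcontfun_pos[OF f(1)] mult_right_le_imp_le by blast
  qed
  ultimately show "\<mu> \<le> lam (int k) + norm (G - \<Gamma>)" using lam_pos by auto
qed simp

text \<open>The span of the first \<open>k\<close> basis functions is the trial space. The counting
  lemma asks for a strict inequality and a positive level, so the level \<open>t\<close> is taken
  below the bound, and nonpositive \<open>t\<close> is trivial.\<close>

lemma kth_eigenvalue_perturbation_lower:
  assumes G: "symmetric_kernel G"
  shows "lam (int k) - norm (G - \<Gamma>) \<le> kth_eigenvalue G k"
proof (rule dense_le)
  fix t assume t: "t < lam (int k) - norm (G - \<Gamma>)"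
  show "t \<le> kth_eigenvalue G k"
  proof (cases "t > 0")
    case False
    then show ?thesis using kth_eigenvalue_nonneg[of G k] by simp
  next
    case True
    let ?A = "{1..int k}"
    have AJ: "?A \<subseteq> J" using pos_in_J by auto
    have lam_ge: "lam j \<ge> lam (int k)" if "j \<in> ?A" for j using that by (intro lam_antimono) auto
    then have nz: "lam j \<noteq> 0" if "j \<in> ?A" for j using that lam_pos by fastforce
    have onA: "orthonormal_family ?A \<phi>" by (rule orthonormal_family_subset[OF onf AJ])
    have "card ?A \<le> eigenvalue_count G t"
    proof (rule card_le_eigenvalue_count[OF G True])
      fix c f assume c: "\<exists>j\<in>?A. c j \<noteq> 0" and f_def: "f = (\<Sum>j\<in>?A. c j *\<^sub>R \<psi> j)"
      have f: "apply_bcontfun f = (\<lambda>x. \<Sum>j\<in>?A. c j * \<phi> j x)"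
        using apply_\<psi>[OF subsetD[OF AJ] nz] by (auto simp: f_def apply_bcontfun_sum)
      have ff: "L2_inner f f = (\<Sum>j\<in>?A. c j * c j)"
        unfolding f by (rule L2_inner_lincomb[OF onA]) simp
      have Tf: "L2_inner (kernel_op \<Gamma> f) f = (\<Sum>j\<in>?A. lam j * (c j * c j))"
      proof -
        have coef: "L2_inner f (\<phi> j) = c j" if "j \<in> ?A" for j
          unfolding f using L2_inner_lincomb_left[OF onA] that by simp
        have "L2_inner (kernel_op \<Gamma> f) f = (\<Sum>j\<in>?A. c j * L2_inner (kernel_op \<Gamma> f) (\<phi> j))"
        proof -
          have "L2_inner (kernel_op \<Gamma> f) (\<lambda>x. \<Sum>j\<in>?A. c j * \<phi> j x)
              = (\<Sum>j\<in>?A. c j * L2_inner (kernel_op \<Gamma> f) (\<phi> j))"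
            by (subst L2_inner_sum_right)
              (auto intro!: L2_scale \<phi>_L2 pos_in_J simp: L2_inner_scale_right)
          then show ?thesis by (simp only: f[symmetric])
        qed
        also have "\<dots> = (\<Sum>j\<in>?A. lam j * (c j * c j))"
          using AJ coef by (intro sum.cong) (auto simp: inner_kernel_op_\<phi>)
        finally show ?thesis .
      qed
      have "(\<Sum>j\<in>?A. c j * c j) \<noteq> 0" using c by (subst sum_nonneg_eq_0_iff) auto
      moreover have "(\<Sum>j\<in>?A. c j * c j) \<ge> 0" by (intro sum_nonneg) auto
      ultimately have pos: "L2_inner f f > 0" unfolding ff by linarith
      have "t * L2_inner f f < (lam (int k) - norm (G - \<Gamma>)) * L2_inner f f"
        using t pos by (rule mult_strict_right_mono)
      also have "lam (int k) * L2_inner f f \<le> L2_inner (kernel_op \<Gamma> f) f"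
        unfolding ff Tf sum_distrib_left using lam_ge by (intro sum_mono mult_right_mono) auto
      then have "(lam (int k) - norm (G - \<Gamma>)) * L2_inner f f
          \<le> L2_inner (kernel_op \<Gamma> f) f + L2_inner (kernel_op (G - \<Gamma>) f) f"
        using kernel_op_quadratic_le[of "G - \<Gamma>" f] by (simp add: left_diff_distrib abs_le_iff)
      also have "\<dots> = L2_inner (kernel_op G f) f"
        by (simp add: kernel_op_diff_kernel L2_inner_simps)
      finally show "t * L2_inner f f < L2_inner (kernel_op G f) f" .
    qed simp
    then show ?thesis using k by (intro kth_eigenvalue_ge[OF G True]) auto
  qed
qed

lemma kth_eigenvalue_perturbation:
  "symmetric_kernel G \<Longrightarrow> \<bar>kth_eigenvalue G k - lam (int k)\<bar> \<le> norm (G - \<Gamma>)"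
  using kth_eigenvalue_perturbation_upper kth_eigenvalue_perturbation_lower by fastforce

end


subsection \<open>The reduced resolvent\<close>

context simple_eigenvalue
begin

text \<open>Completeness of the basis makes the difference vanish in \<open>L2\<close>, full support
  of the measure makes it vanish everywhere. Identities for the resolvent in \<open>C[0,1]\<close>
  thereby reduce to arithmetic on coefficients.\<close>

lemma eq_by_coefficients:
  assumes "\<And>j. j \<in> J \<Longrightarrow> L2_inner (apply_bcontfun f) (\<phi> j) = L2_inner (apply_bcontfun g) (\<phi> j)"
  shows "f = g"
proof -
  let ?d = "f - g"
  have coef: "L2_inner (apply_bcontfun ?d) (\<phi> j) = 0" if "j \<in> J" for j
    using assms[OF that] \<phi>_L2[OF that] by (simp add: L2_inner_diff_left)
  have "((\<lambda>j. L2_inner (\<lambda>x. L2_inner ?d (\<phi> j) * \<phi> j x) ?d) has_sum L2_inner ?d ?d) J"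
    by (rule has_L2_sum_inner[OF basis_sum]) (rule L2_bcontfun)+
  moreover have "((\<lambda>j. L2_inner (\<lambda>x. L2_inner ?d (\<phi> j) * \<phi> j x) ?d) has_sum 0) J"
    by (rule has_sum_0) (subst L2_inner_scale_left, simp only: coef mult_zero_left)
  ultimately have "L2_inner ?d ?d = 0" by (rule has_sum_unique)
  then show ?thesis using L2_norm_bcontfun_eq_0[of ?d] by simp
qed

definition coef :: "(unit_ivl \<Rightarrow> real) \<Rightarrow> int \<Rightarrow> real" where
  "coef h j = L2_inner h (\<phi> j) / (lam (int k) - lam j)"

text \<open>The finite sum is the image of one \<open>L2\<close> function, so its supremum norm is
  at most \<open>norm \<Gamma>\<close> times an \<open>L2\<close> norm, and the gap \<delta> bounds
  that norm by the coefficients of \<open>h\<close>. This gives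
  \<open>C = norm \<Gamma> / \<delta>\<close>.\<close>

lemma norm_partial_sum_le:
  "\<exists>C\<ge>0. \<forall>F h. finite F \<longrightarrow> F \<subseteq> J - {int k} \<longrightarrow>
     norm (\<Sum>j\<in>F. coef h j *\<^sub>R kernel_op \<Gamma> (\<phi> j)) \<le> C * sqrt (\<Sum>j\<in>F. (L2_inner h (\<phi> j))\<^sup>2)"
proof -
  obtain \<delta> where \<delta>: "\<delta> > 0" "\<And>j. j \<in> J - {int k} \<Longrightarrow> \<delta> \<le> \<bar>lam (int k) - lam j\<bar>"
    using spectral_gap by blast
  have "norm (\<Sum>j\<in>F. coef h j *\<^sub>R kernel_op \<Gamma> (\<phi> j))
      \<le> (norm \<Gamma> / \<delta>) * sqrt (\<Sum>j\<in>F. (L2_inner h (\<phi> j))\<^sup>2)"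
    if F: "finite F" "F \<subseteq> J - {int k}" for F h
  proof -
    let ?s = "\<lambda>x. \<Sum>j\<in>F. coef h j * \<phi> j x"
    have L2: "(\<lambda>x. coef h j * \<phi> j x) \<in> L2" if "j \<in> F" for j
      using F that by (intro L2_scale \<phi>_L2) auto
    have "(\<Sum>j\<in>F. coef h j *\<^sub>R kernel_op \<Gamma> (\<phi> j)) = (\<Sum>j\<in>F. kernel_op \<Gamma> (\<lambda>x. coef h j * \<phi> j x))"
      using F \<phi>_L2 by (intro sum.cong) (auto simp: kernel_op_scale)
    also have "\<dots> = kernel_op \<Gamma> ?s"
      by (rule kernel_op_sum[symmetric, OF L2])
    also have "norm \<dots> \<le> norm \<Gamma> * L2_norm ?s"
      by (intro norm_kernel_op L2_sum L2)
    also have "L2_norm ?s = sqrt (\<Sum>j\<in>F. (coef h j)\<^sup>2)"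
      using L2_inner_lincomb[OF orthonormal_family_subset[OF onf] F(1)] F(2)
      by (auto simp: L2_norm_def power2_eq_square)
    also have "\<dots> \<le> sqrt (\<Sum>j\<in>F. (1 / \<delta>)\<^sup>2 * (L2_inner h (\<phi> j))\<^sup>2)"
    proof (intro real_sqrt_le_mono sum_mono)
      fix j assume "j \<in> F"
      then have d: "\<delta> \<le> \<bar>lam (int k) - lam j\<bar>" using F \<delta>(2) by blast
      have "\<bar>coef h j\<bar> \<le> \<bar>L2_inner h (\<phi> j)\<bar> / \<delta>"
        unfolding coef_def abs_divide using d \<delta>(1) by (intro divide_left_mono) auto
      then have "\<bar>coef h j\<bar>\<^sup>2 \<le> (\<bar>L2_inner h (\<phi> j)\<bar> / \<delta>)\<^sup>2" by (rule power_mono) simp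
      then show "(coef h j)\<^sup>2 \<le> (1 / \<delta>)\<^sup>2 * (L2_inner h (\<phi> j))\<^sup>2"
        by (simp add: power_divide)
    qed
    also have "\<dots> = (1 / \<delta>) * sqrt (\<Sum>j\<in>F. (L2_inner h (\<phi> j))\<^sup>2)"
      using \<delta>(1) unfolding sum_distrib_left[symmetric] real_sqrt_mult by simp
    finally show ?thesis by (simp add: mult_left_mono)
  qed
  then show ?thesis using \<delta>(1) by (intro exI[of _ "norm \<Gamma> / \<delta>"]) auto
qed

text \<open>Removing the partial sum over \<open>F0\<close> leaves the coefficients outside
  \<open>F0\<close> unchanged, so Bessel for the small remainder bounds the tail.\<close>

lemma coefficient_tail:
  assumes h: "h \<in> L2" and e: "e > 0"
  shows "\<exists>F0. finite F0 \<and> F0 \<subseteq> J \<and>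
    (\<forall>F. finite F \<and> F \<subseteq> J \<and> F \<inter> F0 = {} \<longrightarrow> sqrt (\<Sum>j\<in>F. (L2_inner h (\<phi> j))\<^sup>2) < e)"
proof -
  let ?r = "\<lambda>F0 x. h x - (\<Sum>j\<in>F0. L2_inner h (\<phi> j) * \<phi> j x)"
  have "\<forall>\<^sub>F F in finite_subsets_at_top J. L2_norm (?r F) < e"
    using basis_sum[OF h] e unfolding has_L2_sum_def by (auto dest: order_tendstoD(2))
  then obtain F0 where F0: "finite F0" "F0 \<subseteq> J" "L2_norm (?r F0) < e"
    unfolding eventually_finite_subsets_at_top by blast
  have "sqrt (\<Sum>j\<in>F. (L2_inner h (\<phi> j))\<^sup>2) < e" if F: "finite F" "F \<subseteq> J" "F \<inter> F0 = {}" for F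
  proof -
    have L2: "(\<lambda>x. c * \<phi> j x) \<in> L2" if "j \<in> F0" for j c
      using F0 that by (intro L2_scale \<phi>_L2) auto
    have r: "?r F0 \<in> L2" using h L2 by (intro L2_diff L2_sum)
    have "L2_inner (?r F0) (\<phi> j) = L2_inner h (\<phi> j)" if "j \<in> F" for j
    proof -
      have j: "j \<in> J" "j \<notin> F0" using F that by auto
      have "L2_inner (?r F0) (\<phi> j)
          = L2_inner h (\<phi> j) - (\<Sum>i\<in>F0. L2_inner h (\<phi> i) * L2_inner (\<phi> i) (\<phi> j))"
        using h L2 \<phi>_L2[OF j(1)] by (simp add: L2_inner_simps L2_sum)
      moreover have "(\<Sum>i\<in>F0. L2_inner h (\<phi> i) * L2_inner (\<phi> i) (\<phi> j)) = 0"
      proof (intro sum.neutral ballI)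
        fix i assume "i \<in> F0"
        then have "i \<in> J" "i \<noteq> j" using F0(2) j(2) by auto
        then show "L2_inner h (\<phi> i) * L2_inner (\<phi> i) (\<phi> j) = 0"
          using orthonormal_familyD(2)[OF onf _ j(1)] by simp
      qed
      ultimately show ?thesis by simp
    qed
    then have "(\<Sum>j\<in>F. (L2_inner h (\<phi> j))\<^sup>2) = (\<Sum>j\<in>F. (L2_inner (?r F0) (\<phi> j))\<^sup>2)"
      by simp
    also have "\<dots> \<le> L2_inner (?r F0) (?r F0)"
      by (rule L2_Bessel[OF orthonormal_family_subset[OF onf F(2)] F(1) r])
    finally have "sqrt (\<Sum>j\<in>F. (L2_inner h (\<phi> j))\<^sup>2) \<le> L2_norm (?r F0)"
      unfolding L2_norm_def by (rule real_sqrt_le_mono)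
    then show ?thesis using F0(3) by linarith
  qed
  then show ?thesis using F0 by blast
qed

lemma summable_kernel_op_\<phi>:
  assumes h: "h \<in> L2"
  shows "(\<lambda>j. coef h j *\<^sub>R kernel_op \<Gamma> (\<phi> j)) summable_on (J - {int k})"
proof (rule summable_on_Cauchy_criterion)
  fix e :: real assume e: "e > 0"
  obtain C where C: "C \<ge> 0" "\<forall>F h. finite F \<longrightarrow> F \<subseteq> J - {int k} \<longrightarrow>
     norm (\<Sum>j\<in>F. coef h j *\<^sub>R kernel_op \<Gamma> (\<phi> j)) \<le> C * sqrt (\<Sum>j\<in>F. (L2_inner h (\<phi> j))\<^sup>2)"
    using norm_partial_sum_le by (elim exE conjE)
  \<comment> \<open>\<open>C\<close> itself may be 0.\<close>
  have "e / (C + 1) > 0" using e C(1) by simp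
  from coefficient_tail[OF h this] obtain F0 where F0: "finite F0" "F0 \<subseteq> J"
    and tail: "\<forall>F. finite F \<and> F \<subseteq> J \<and> F \<inter> F0 = {} \<longrightarrow>
      sqrt (\<Sum>j\<in>F. (L2_inner h (\<phi> j))\<^sup>2) < e / (C + 1)"
    by (elim exE conjE)
  have "norm (\<Sum>j\<in>F. coef h j *\<^sub>R kernel_op \<Gamma> (\<phi> j)) < e"
    if F: "finite F" "F \<subseteq> J - {int k}" "F \<inter> (F0 - {int k}) = {}" for F
  proof -
    have "sqrt (\<Sum>j\<in>F. (L2_inner h (\<phi> j))\<^sup>2) < e / (C + 1)"
      using F by (intro tail[rule_format]) auto
    then have "C * sqrt (\<Sum>j\<in>F. (L2_inner h (\<phi> j))\<^sup>2) \<le> C * (e / (C + 1))"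
      using C(1) by (intro mult_left_mono) auto
    also have "\<dots> < e" using C(1) e by (simp add: field_simps)
    finally show ?thesis using C(2)[rule_format, OF F(1,2), of h] by linarith
  qed
  then show "\<exists>F0. finite F0 \<and> F0 \<subseteq> J - {int k} \<and> (\<forall>F. finite F \<and> F \<subseteq> J - {int k} \<and> F \<inter> F0 = {} \<longrightarrow>
      norm (\<Sum>j\<in>F. coef h j *\<^sub>R kernel_op \<Gamma> (\<phi> j)) < e)"
    using F0 by (intro exI[of _ "F0 - {int k}"]) auto
qed

text \<open>In \<open>L2\<close> this is the series of
  \<open>lam j / (lam (int k) - lam j) * L2_inner h (\<phi> j)\<close> times
  \<open>\<phi> j\<close>. Writing \<open>kernel_op \<Gamma> (\<phi> j)\<close> for
  \<open>lam j\<close> times \<open>\<phi> j\<close> makes every term continuous, also where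
  \<open>\<phi> j\<close> is not.\<close>

definition smooth_part :: "(unit_ivl \<Rightarrow>\<^sub>C real) \<Rightarrow> (unit_ivl \<Rightarrow>\<^sub>C real)" where
  "smooth_part h = (\<Sum>\<^sub>\<infinity>j\<in>J - {int k}. coef h j *\<^sub>R kernel_op \<Gamma> (\<phi> j))"

lemma has_sum_smooth_part:
  "((\<lambda>j. coef (apply_bcontfun h) j *\<^sub>R kernel_op \<Gamma> (\<phi> j)) has_sum smooth_part h) (J - {int k})"
  unfolding smooth_part_def by (intro has_sum_infsum summable_kernel_op_\<phi>) simp

lemma norm_smooth_part_le: "\<exists>C\<ge>0. \<forall>h. norm (smooth_part h) \<le> C * norm h"
proof -
  obtain C where C: "C \<ge> 0" "\<forall>F h. finite F \<longrightarrow> F \<subseteq> J - {int k} \<longrightarrow>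
     norm (\<Sum>j\<in>F. coef h j *\<^sub>R kernel_op \<Gamma> (\<phi> j)) \<le> C * sqrt (\<Sum>j\<in>F. (L2_inner h (\<phi> j))\<^sup>2)"
    using norm_partial_sum_le by (elim exE conjE)
  have "norm (smooth_part h) \<le> C * norm h" for h :: "unit_ivl \<Rightarrow>\<^sub>C real"
  proof (rule tendsto_upperbound)
    show "((\<lambda>F. norm (\<Sum>j\<in>F. coef (apply_bcontfun h) j *\<^sub>R kernel_op \<Gamma> (\<phi> j))) \<longlongrightarrow> norm (smooth_part h))
        (finite_subsets_at_top (J - {int k}))"
      using has_sum_smooth_part[of h] unfolding has_sum_def by (rule tendsto_norm)
    show "\<forall>\<^sub>F F in finite_subsets_at_top (J - {int k}).
        norm (\<Sum>j\<in>F. coef (apply_bcontfun h) j *\<^sub>R kernel_op \<Gamma> (\<phi> j)) \<le> C * norm h"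
    proof (rule eventually_finite_subsets_at_top_weakI)
      fix F assume F: "finite F" "F \<subseteq> J - {int k}"
      then have "F \<subseteq> J" by blast
      have "sqrt (\<Sum>j\<in>F. (L2_inner (apply_bcontfun h) (\<phi> j))\<^sup>2) \<le> L2_norm h"
        unfolding L2_norm_def
        by (intro real_sqrt_le_mono L2_Bessel[OF orthonormal_family_subset[OF onf \<open>F \<subseteq> J\<close>] F(1)]) simp
      also have "\<dots> \<le> norm h" by (rule L2_norm_le_norm)
      finally have "C * sqrt (\<Sum>j\<in>F. (L2_inner (apply_bcontfun h) (\<phi> j))\<^sup>2) \<le> C * norm h"
        using C(1) by (rule mult_left_mono)
      then show "norm (\<Sum>j\<in>F. coef (apply_bcontfun h) j *\<^sub>R kernel_op \<Gamma> (\<phi> j)) \<le> C * norm h"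
        using C(2)[rule_format, OF F, of h] by linarith
    qed
  qed simp
  then show ?thesis using C(1) by blast
qed

lemma inner_smooth_part:
  assumes i: "i \<in> J"
  shows "L2_inner (smooth_part h) (\<phi> i) = (if i = int k then 0 else coef (apply_bcontfun h) i * lam i)"
proof -
  have summand: "L2_inner (apply_bcontfun (coef (apply_bcontfun h) j *\<^sub>R kernel_op \<Gamma> (\<phi> j))) (\<phi> i)
      = (if j = i then coef (apply_bcontfun h) i * lam i else 0)" if "j \<in> J" for j
    using inner_kernel_op_\<phi>[OF \<phi>_L2[OF that] i] orthonormal_familyD(2)[OF onf that i]
    by (simp add: L2_inner_scale_left)
  have "((\<lambda>j. L2_inner (apply_bcontfun (coef (apply_bcontfun h) j *\<^sub>R kernel_op \<Gamma> (\<phi> j))) (\<phi> i))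
      has_sum L2_inner (smooth_part h) (\<phi> i)) (J - {int k})"
    using has_sum_bounded_linear[OF bounded_linear_L2_inner[OF \<phi>_L2[OF i]] has_sum_smooth_part] .
  moreover have "((\<lambda>j. L2_inner (apply_bcontfun (coef (apply_bcontfun h) j *\<^sub>R kernel_op \<Gamma> (\<phi> j))) (\<phi> i))
      has_sum (if i = int k then 0 else coef (apply_bcontfun h) i * lam i)) (J - {int k})"
    using i by (intro has_sum_finite_neutralI[of "{i} - {int k}"]) (auto simp: summand simp del: scaleR_bcontfun.rep_eq)
  ultimately show ?thesis by (rule has_sum_unique)
qed

text \<open>On \<open>L\<^sub>2[0,1]\<close> the reduced resolvent is multiplication by \<open>1 / (\<lambda>\<^sub>k - \<lambda>\<^sub>j)\<close> on \<open>\<phi>\<^sub>j\<close>, \<open>j \<noteq> k\<close>. Splitting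
  \<open>1 / (\<lambda>\<^sub>k - \<lambda>\<^sub>j) = (1 + \<lambda>\<^sub>j / (\<lambda>\<^sub>k - \<lambda>\<^sub>j)) / \<lambda>\<^sub>k\<close> leaves a series of continuous functions
  \<open>\<lambda>\<^sub>j \<phi>\<^sub>j\<close> that converges uniformly, so that the operator acts on \<open>C[0,1]\<close>.\<close>

definition resolvent :: "(unit_ivl \<Rightarrow>\<^sub>C real) \<Rightarrow> (unit_ivl \<Rightarrow>\<^sub>C real)" where
  "resolvent h = (1 / lam (int k)) *\<^sub>R (h - L2_inner h (\<phi> (int k)) *\<^sub>R \<psi> (int k) + smooth_part h)"

lemma inner_resolvent:
  assumes i: "i \<in> J"
  shows "L2_inner (resolvent h) (\<phi> i) = (if i = int k then 0 else coef (apply_bcontfun h) i)"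
proof -
  have "L2_inner (resolvent h) (\<phi> i) = (1 / lam (int k)) *
      (L2_inner h (\<phi> i) - L2_inner h (\<phi> (int k)) * L2_inner (\<phi> (int k)) (\<phi> i) + L2_inner (smooth_part h) (\<phi> i))"
    unfolding resolvent_def scaleR_bcontfun.rep_eq[of "1 / lam (int k)"] real_scaleR_def L2_inner_scale_left
    using \<phi>_L2[OF i] \<phi>_L2[OF k_in_J] by (simp add: L2_inner_simps L2_intros)
  also have "\<dots> = (if i = int k then 0 else coef (apply_bcontfun h) i)"
  proof (cases "i = int k")
    case True
    then show ?thesis
      using inner_smooth_part[OF i, of h] orthonormal_familyD(2)[OF onf k_in_J i] by simp
  next
    case False
    then have ne: "lam (int k) - lam i \<noteq> 0" using lam_neq[OF i] by simp
    have "L2_inner h (\<phi> i) + coef (apply_bcontfun h) i * lam i = lam (int k) * coef (apply_bcontfun h) i"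
      using ne by (simp add: coef_def field_simps)
    then show ?thesis
      using False inner_smooth_part[OF i, of h] orthonormal_familyD(2)[OF onf k_in_J i] lam_pos
      by (simp add: field_simps)
  qed
  finally show ?thesis .
qed

text \<open>Linearity is read off from the coefficients, without rearranging the infinite sum; the
  norm bound comes from the three summands of the definition.\<close>

lemma bounded_linear_resolvent: "bounded_linear resolvent"
proof -
  obtain C where C: "C \<ge> 0" "\<And>h. norm (smooth_part h) \<le> C * norm h"
    using norm_smooth_part_le by blast
  show ?thesis
  proof (rule bounded_linear_intro)
    fix g h :: "unit_ivl \<Rightarrow>\<^sub>C real"
    show "resolvent (g + h) = resolvent g + resolvent h"
      using \<phi>_L2 k_in_J
      by (intro eq_by_coefficients)
        (simp add: inner_resolvent coef_def L2_inner_add_left add_divide_distrib)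
  next
    fix c :: real and h :: "unit_ivl \<Rightarrow>\<^sub>C real"
    show "resolvent (c *\<^sub>R h) = c *\<^sub>R resolvent h"
      by (intro eq_by_coefficients) (simp add: inner_resolvent coef_def L2_inner_scale_left)
  next
    fix h :: "unit_ivl \<Rightarrow>\<^sub>C real"
    have "\<bar>L2_inner h (\<phi> (int k))\<bar> \<le> L2_norm h * L2_norm (\<phi> (int k))"
      by (intro L2_Cauchy_Schwarz \<phi>_L2 k_in_J) simp
    also have "\<dots> \<le> norm h"
      using orthonormal_familyD(2)[OF onf k_in_J k_in_J] L2_norm_le_norm[of h]
      by (simp add: L2_norm_def)
    finally have "\<bar>L2_inner h (\<phi> (int k))\<bar> * norm (\<psi> (int k)) \<le> norm h * norm (\<psi> (int k))"
      by (rule mult_right_mono) simp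
    then have "norm (h - L2_inner h (\<phi> (int k)) *\<^sub>R \<psi> (int k) + smooth_part h)
        \<le> norm h + norm h * norm (\<psi> (int k)) + C * norm h"
      using C(2)[of h] norm_triangle_ineq[of "h - L2_inner h (\<phi> (int k)) *\<^sub>R \<psi> (int k)" "smooth_part h"]
        norm_triangle_ineq4[of h "L2_inner h (\<phi> (int k)) *\<^sub>R \<psi> (int k)"]
      by simp
    also have "\<dots> = norm h * (1 + norm (\<psi> (int k)) + C)" by (simp add: algebra_simps)
    finally have "(1 / lam (int k)) * norm (h - L2_inner h (\<phi> (int k)) *\<^sub>R \<psi> (int k) + smooth_part h)
        \<le> (1 / lam (int k)) * (norm h * (1 + norm (\<psi> (int k)) + C))"
      using lam_pos by (intro mult_left_mono) auto
    then show "norm (resolvent h) \<le> norm h * ((1 / lam (int k)) * (1 + norm (\<psi> (int k)) + C))"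
      using lam_pos by (simp add: resolvent_def mult_ac)
  qed
qed

lemma has_L2_sum_resolvent:
  "has_L2_sum (\<lambda>j x. L2_inner (apply_bcontfun h) (\<phi> j) / (lam (int k) - lam j) * \<phi> j x) (J - {int k}) (resolvent h)"
proof -
  let ?g = "\<lambda>j x. L2_inner (resolvent h) (\<phi> j) * \<phi> j x"
  let ?g' = "\<lambda>j x. L2_inner (apply_bcontfun h) (\<phi> j) / (lam (int k) - lam j) * \<phi> j x"
  let ?N = "\<lambda>g F. L2_norm (\<lambda>x. resolvent h x - (\<Sum>j\<in>F. g j x))"
  have g_eq: "?g j x = ?g' j x" if "j \<in> J - {int k}" for j x
    using inner_resolvent[of j h] that by (simp add: coef_def)
  have lim: "(?N ?g \<longlongrightarrow> 0) (finite_subsets_at_top J)"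
    using basis_sum[OF L2_bcontfun] by (simp add: has_L2_sum_def)
  have "(?N ?g' \<longlongrightarrow> 0) (finite_subsets_at_top (J - {int k}))"
    unfolding tendsto_iff
  proof (intro allI impI)
    fix e :: real assume "e > 0"
    then have "\<forall>\<^sub>F F in finite_subsets_at_top J. dist (?N ?g F) 0 < e"
      using lim unfolding tendsto_iff by blast
    then obtain F0 where F0: "finite F0" "F0 \<subseteq> J"
      and small: "\<forall>F. finite F \<and> F0 \<subseteq> F \<and> F \<subseteq> J \<longrightarrow> dist (?N ?g F) 0 < e"
      unfolding eventually_finite_subsets_at_top by (elim exE conjE)
    have "dist (?N ?g' F) 0 < e" if F: "finite F" "F0 - {int k} \<subseteq> F" "F \<subseteq> J - {int k}" for F
    proof -
      \<comment> \<open>The coefficient at \<open>k\<close> is 0, so partial sums over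
        \<open>J - {int k}\<close> are also partial sums over \<open>J\<close>, for which basis
        convergence is available.\<close>
      have "(\<Sum>j\<in>insert (int k) F. ?g j x) = (\<Sum>j\<in>F. ?g' j x)" for x
      proof -
        have "(\<Sum>j\<in>insert (int k) F. ?g j x) = ?g (int k) x + (\<Sum>j\<in>F. ?g j x)"
          using F by (intro sum.insert) auto
        moreover have "?g (int k) x = 0" by (simp add: inner_resolvent[OF k_in_J])
        moreover have "(\<Sum>j\<in>F. ?g j x) = (\<Sum>j\<in>F. ?g' j x)"
          using F g_eq by (intro sum.cong) auto
        ultimately show ?thesis by simp
      qed
      then show ?thesis
        using small[rule_format, of "insert (int k) F"] F k_in_J by auto
    qed
    then show "\<forall>\<^sub>F F in finite_subsets_at_top (J - {int k}). dist (?N ?g' F) 0 < e"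
      unfolding eventually_finite_subsets_at_top using F0 by (intro exI[of _ "F0 - {int k}"]) auto
  qed
  then show ?thesis
    unfolding has_L2_sum_def by (intro conjI ballI L2_scale \<phi>_L2 L2_bcontfun) auto
qed

lemma resolvent_left_inverse:
  "resolvent (lam (int k) *\<^sub>R h - kernel_op \<Gamma> (apply_bcontfun h)) = h - L2_inner (apply_bcontfun h) (\<phi> (int k)) *\<^sub>R \<psi> (int k)"
proof (rule eq_by_coefficients)
  fix j assume j: "j \<in> J"
  have "L2_inner (apply_bcontfun (lam (int k) *\<^sub>R h - kernel_op \<Gamma> (apply_bcontfun h))) (\<phi> j)
      = (lam (int k) - lam j) * L2_inner (apply_bcontfun h) (\<phi> j)"
    using \<phi>_L2[OF j] inner_kernel_op_\<phi>[OF _ j, of h]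
    by (simp add: L2_inner_simps L2_intros left_diff_distrib)
  moreover have "L2_inner (apply_bcontfun (h - L2_inner (apply_bcontfun h) (\<phi> (int k)) *\<^sub>R \<psi> (int k))) (\<phi> j)
      = L2_inner (apply_bcontfun h) (\<phi> j) - L2_inner (apply_bcontfun h) (\<phi> (int k)) * L2_inner (\<phi> (int k)) (\<phi> j)"
    using \<phi>_L2[OF j] \<phi>_L2[OF k_in_J] by (simp add: L2_inner_simps L2_intros)
  ultimately show "L2_inner (apply_bcontfun (resolvent (lam (int k) *\<^sub>R h - kernel_op \<Gamma> (apply_bcontfun h)))) (\<phi> j)
      = L2_inner (apply_bcontfun (h - L2_inner (apply_bcontfun h) (\<phi> (int k)) *\<^sub>R \<psi> (int k))) (\<phi> j)"
    using lam_neq[OF j] orthonormal_familyD(2)[OF onf k_in_J j]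
    by (auto simp: inner_resolvent[OF j] coef_def)
qed

text \<open>This cancellation lets \<open>f\<close> be replaced by \<open>f - \<psi> (int k)\<close>
  in the eigenvalue term and so gains one order.\<close>

lemma resolvent_\<psi>_k: "resolvent (\<psi> (int k)) = 0"
proof (rule eq_by_coefficients)
  fix j assume j: "j \<in> J"
  then show "L2_inner (apply_bcontfun (resolvent (\<psi> (int k)))) (\<phi> j) = L2_inner (apply_bcontfun 0) (\<phi> j)"
    using orthonormal_familyD(2)[OF onf k_in_J j]
    by (auto simp: inner_resolvent coef_def) (simp_all add: L2_inner_def)
qed


subsection \<open>First order perturbation of the eigenfunction\<close>

lemma eigenfunction_expansion:
  "\<exists>C\<ge>0. \<forall>G f. symmetric_kernel G \<longrightarrow> norm (G - \<Gamma>) < lam (int k) / 2 \<longrightarrow>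
     f \<in> eigenspace G (kth_eigenvalue G k) \<longrightarrow> L2_norm (apply_bcontfun f) = 1 \<longrightarrow>
     0 \<le> L2_inner (apply_bcontfun f) (\<phi> (int k)) \<longrightarrow>
     norm (f - \<psi> (int k) - resolvent (kernel_op (G - \<Gamma>) (\<phi> (int k)))) \<le> C * (norm (G - \<Gamma>))\<^sup>2"
proof -
  interpret S: bounded_linear resolvent by (rule bounded_linear_resolvent)
  obtain R where R: "R > 0" "\<And>h. norm (resolvent h) \<le> norm h * R" using S.pos_bounded by blast
  let ?l = "lam (int k)" and ?\<psi> = "\<psi> (int k)"
  \<comment> \<open>The constants bound, in turn, \<open>norm f\<close>, then the component
    \<open>w\<close> of \<open>f\<close> off \<open>\<psi> (int k)\<close> and the difference
    \<open>f - \<psi> (int k)\<close>, both relative to \<open>d\<close>, and the final remainder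
    relative to the square of \<open>d\<close>.\<close>
  define B where "B = 2 * (norm \<Gamma> + ?l) / ?l"
  define D1 where "D1 = R * (B + 1)"
  define D2 where "D2 = D1 + D1\<^sup>2 * ?l * norm ?\<psi>"
  define C where "C = D1\<^sup>2 * norm ?\<psi> + 2 * R * D2"
  have nonneg: "B \<ge> 0" "D1 \<ge> 0" "D2 \<ge> 0" "C \<ge> 0"
    using lam_pos R(1) by (auto simp: B_def D1_def D2_def C_def)
  have "norm (f - ?\<psi> - resolvent (kernel_op (G - \<Gamma>) (\<phi> (int k)))) \<le> C * (norm (G - \<Gamma>))\<^sup>2"
    if G: "symmetric_kernel G" and d2: "norm (G - \<Gamma>) < ?l / 2"
      and f: "f \<in> eigenspace G (kth_eigenvalue G k)" "L2_norm (apply_bcontfun f) = 1"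
        "0 \<le> L2_inner (apply_bcontfun f) (\<phi> (int k))" for G f
  proof -
    define d where "d = norm (G - \<Gamma>)"
    define \<mu> where "\<mu> = kth_eigenvalue G k"
    define c where "c = L2_inner f (\<phi> (int k))"
    define w where "w = f - c *\<^sub>R ?\<psi>"
    interpret D: bounded_linear "\<lambda>f. kernel_op (G - \<Gamma>) (apply_bcontfun f)"
      by (rule bounded_linear_kernel_op)
    have d: "0 \<le> d" "d < ?l / 2" using d2 by (auto simp: d_def)
    have \<mu>_diff: "\<bar>\<mu> - ?l\<bar> \<le> d"
      unfolding \<mu>_def d_def by (rule kth_eigenvalue_perturbation[OF G])
    then have \<mu>: "?l / 2 \<le> \<mu>" using d by linarith
    have Gf: "kernel_op G f = \<mu> *\<^sub>R f" using f(1) by (simp add: eigenspace_iff \<mu>_def)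
    \<comment> \<open>The eigenvalue equation upgrades the \<open>L2\<close> normalization to a
      supremum bound, because \<mu> stays above \<open>?l / 2\<close>.\<close>
    have fB: "norm f \<le> B"
    proof -
      have "?l / 2 * norm f \<le> \<mu> * norm f" using \<mu> by (rule mult_right_mono) simp
      also have "\<dots> = norm (kernel_op G f)" using Gf \<mu> lam_pos by simp
      also have "\<dots> \<le> norm G * L2_norm f" by (rule norm_kernel_op) simp
      also have "\<dots> \<le> norm \<Gamma> + ?l"
        using norm_triangle_ineq2[of G \<Gamma>] d f(2) lam_pos by (simp add: d_def)
      finally show ?thesis using lam_pos by (simp add: B_def field_simps)
    qed
    have w_eq: "w = resolvent ((?l - \<mu>) *\<^sub>R f + kernel_op (G - \<Gamma>) f)"
    proof -
      have "?l *\<^sub>R f - kernel_op \<Gamma> f = (?l - \<mu>) *\<^sub>R f + kernel_op (G - \<Gamma>) f"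
        using Gf by (simp add: kernel_op_diff_kernel scaleR_left_diff_distrib)
      then show ?thesis using resolvent_left_inverse[of f] by (simp add: w_def c_def)
    qed
    have wD1: "norm w \<le> D1 * d"
    proof -
      have "norm (kernel_op (G - \<Gamma>) f) \<le> d"
        using norm_kernel_op[of f "G - \<Gamma>"] f(2) by (simp add: d_def)
      moreover have "norm ((?l - \<mu>) *\<^sub>R f) \<le> d * B"
        using \<mu>_diff fB d(1) by (simp add: abs_minus_commute mult_mono)
      ultimately have "norm ((?l - \<mu>) *\<^sub>R f + kernel_op (G - \<Gamma>) f) \<le> d * (B + 1)"
        using norm_triangle_ineq[of "(?l - \<mu>) *\<^sub>R f" "kernel_op (G - \<Gamma>) f"] by (simp add: distrib_left)
      then have "norm w \<le> d * (B + 1) * R"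
        unfolding w_eq using R(2) mult_right_mono R(1) order_trans by (meson less_imp_le)
      then show ?thesis by (simp add: D1_def mult_ac)
    qed
    \<comment> \<open>By Pythagoras the squared \<open>L2\<close> norm of \<open>w\<close> is
      \<open>1 - c\<^sup>2\<close>. Since \<open>c\<close> lies between 0 and 1, by the sign
      convention, this dominates \<open>1 - c\<close>.\<close>
    have c1: "\<bar>1 - c\<bar> \<le> D1\<^sup>2 * d\<^sup>2"
    proof -
      have ff: "L2_inner f f = 1" using f(2) L2_norm_power2[of f] by simp
      have "L2_inner w w = L2_inner f f - 2 * c * L2_inner f (\<phi> (int k))
          + c\<^sup>2 * L2_inner (\<phi> (int k)) (\<phi> (int k))"
        using \<phi>_L2[OF k_in_J]
        by (simp add: w_def L2_inner_simps L2_intros L2_inner_commute[of "\<phi> (int k)" f]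
            power2_eq_square algebra_simps)
      then have ww: "L2_inner w w = 1 - c\<^sup>2"
        using orthonormal_familyD(2)[OF onf k_in_J k_in_J] ff
        by (simp add: c_def[symmetric] power2_eq_square)
      have c0: "0 \<le> c" using f(3) by (simp add: c_def)
      have "c\<^sup>2 \<le> 1\<^sup>2" using ww L2_inner_self_nonneg[of w] by simp
      then have c_le: "c \<le> 1" using abs_le_square_iff[of c 1] by simp
      have "c * c \<le> 1 * c" using c0 c_le by (intro mult_right_mono)
      then have "1 - c \<le> L2_inner w w" unfolding ww by (simp add: power2_eq_square)
      also have "\<dots> \<le> (norm w)\<^sup>2"
        unfolding L2_norm_power2[symmetric] by (intro power_mono L2_norm_le_norm) simp
      also have "\<dots> \<le> (D1 * d)\<^sup>2" using wD1 by (intro power_mono) auto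
      finally show ?thesis using c_le by (simp add: power_mult_distrib)
    qed
    have f\<psi>: "f - ?\<psi> = w - (1 - c) *\<^sub>R ?\<psi>" by (simp add: w_def algebra_simps)
    have fD2: "norm (f - ?\<psi>) \<le> D2 * d"
    proof -
      have "norm (f - ?\<psi>) \<le> norm w + \<bar>1 - c\<bar> * norm ?\<psi>"
        unfolding f\<psi> using norm_triangle_ineq4[of w "(1 - c) *\<^sub>R ?\<psi>"] by simp
      also have "\<bar>1 - c\<bar> * norm ?\<psi> \<le> (D1\<^sup>2 * d\<^sup>2) * norm ?\<psi>" using c1 by (rule mult_right_mono) simp
      also have "D1\<^sup>2 * d\<^sup>2 * norm ?\<psi> = (D1\<^sup>2 * norm ?\<psi> * d) * d" by (simp add: power2_eq_square)
      \<comment> \<open>One of the two factors \<open>d\<close> is given up, using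
        \<open>d < ?l / 2\<close>; a linear bound is all that is wanted here.\<close>
      also have "\<dots> \<le> (D1\<^sup>2 * norm ?\<psi> * ?l) * d" using d lam_pos by (intro mult_right_mono mult_left_mono) auto
      finally show ?thesis using wD1 by (simp add: D2_def algebra_simps)
    qed
    have Sw: "w = (?l - \<mu>) *\<^sub>R resolvent (f - ?\<psi>) + resolvent (kernel_op (G - \<Gamma>) f)"
      unfolding w_eq S.add S.scaleR S.diff resolvent_\<psi>_k by simp
    have SD: "resolvent (kernel_op (G - \<Gamma>) (f - ?\<psi>))
        = resolvent (kernel_op (G - \<Gamma>) f) - resolvent (kernel_op (G - \<Gamma>) ?\<psi>)"
      unfolding D.diff S.diff ..
    have "f - ?\<psi> - resolvent (kernel_op (G - \<Gamma>) ?\<psi>)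
        = w - (1 - c) *\<^sub>R ?\<psi> - resolvent (kernel_op (G - \<Gamma>) ?\<psi>)"
      by (simp only: f\<psi>)
    also have "\<dots> = (?l - \<mu>) *\<^sub>R resolvent (f - ?\<psi>) + resolvent (kernel_op (G - \<Gamma>) (f - ?\<psi>))
        - (1 - c) *\<^sub>R ?\<psi>"
      unfolding SD by (subst Sw) simp
    also have "norm \<dots> \<le> norm ((?l - \<mu>) *\<^sub>R resolvent (f - ?\<psi>))
        + norm (resolvent (kernel_op (G - \<Gamma>) (f - ?\<psi>))) + norm ((1 - c) *\<^sub>R ?\<psi>)"
      by (rule order_trans[OF norm_triangle_ineq4 add_right_mono[OF norm_triangle_ineq]])
    also have "norm ((?l - \<mu>) *\<^sub>R resolvent (f - ?\<psi>)) \<le> R * D2 * d\<^sup>2"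
    proof -
      have "norm (resolvent (f - ?\<psi>)) \<le> D2 * d * R"
        using R(2)[of "f - ?\<psi>"] mult_right_mono[OF fD2, of R] R(1) by linarith
      then have "\<bar>?l - \<mu>\<bar> * norm (resolvent (f - ?\<psi>)) \<le> d * (D2 * d * R)"
        using \<mu>_diff d(1) by (intro mult_mono) auto
      then show ?thesis by (simp add: power2_eq_square mult_ac)
    qed
    also have "norm (resolvent (kernel_op (G - \<Gamma>) (f - ?\<psi>))) \<le> R * D2 * d\<^sup>2"
    proof -
      have "norm (kernel_op (G - \<Gamma>) (f - ?\<psi>)) \<le> d * L2_norm (f - ?\<psi>)"
        unfolding d_def by (rule norm_kernel_op) (rule L2_bcontfun)
      also have "\<dots> \<le> d * (D2 * d)"
        using d(1) by (intro mult_left_mono order_trans[OF L2_norm_le_norm fD2])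
      finally have "norm (kernel_op (G - \<Gamma>) (f - ?\<psi>)) * R \<le> d * (D2 * d) * R"
        using R(1) by (intro mult_right_mono) auto
      then show ?thesis
        using R(2)[of "kernel_op (G - \<Gamma>) (f - ?\<psi>)"] by (simp add: power2_eq_square mult_ac)
    qed
    also have "norm ((1 - c) *\<^sub>R ?\<psi>) \<le> D1\<^sup>2 * d\<^sup>2 * norm ?\<psi>"
      using mult_right_mono[OF c1, of "norm ?\<psi>"] by simp
    finally have "norm (f - ?\<psi> - resolvent (kernel_op (G - \<Gamma>) ?\<psi>)) \<le> C * d\<^sup>2"
      by (simp add: C_def algebra_simps)
    then show ?thesis by (simp add: d_def)
  qed
  then show ?thesis using nonneg(4) by blast
qed

end


subsection \<open>The delta method\<close>

text \<open>Stronger than uniform continuity on \<open>K\<close>, as \<open>y\<close> may lie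
  outside \<open>K\<close>. The radius is a Lebesgue number of a cover by preimages of small
  balls.\<close>

lemma uniformly_near_compact:
  fixes f :: "'a::metric_space \<Rightarrow> real"
  assumes K: "compact K" and f: "continuous_on UNIV f" and e: "e > 0"
  shows "\<exists>d>0. \<forall>x\<in>K. \<forall>y. dist x y < d \<longrightarrow> \<bar>f x - f y\<bar> < e"
proof -
  let ?C = "range (\<lambda>z. f -` ball (f z) (e / 2))"
  have open_C: "\<And>U. U \<in> ?C \<Longrightarrow> open U" using f by (auto intro: open_vimage)
  have cover: "K \<subseteq> \<Union>?C"
  proof
    fix x assume "x \<in> K"
    have "x \<in> f -` ball (f x) (e / 2)" using e by simp
    then show "x \<in> \<Union>?C" by blast
  qed
  obtain d where d: "d > 0" "\<And>x. x \<in> K \<Longrightarrow> \<exists>U\<in>?C. ball x d \<subseteq> U"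
    by (rule Heine_Borel_lemma[OF K cover open_C]) (assumption | rule that)+
  have "\<bar>f x - f y\<bar> < e" if x: "x \<in> K" and y: "dist x y < d" for x y
  proof -
    obtain z where z: "ball x d \<subseteq> f -` ball (f z) (e / 2)" using d(2)[OF x] by blast
    have "x \<in> ball x d" "y \<in> ball x d" using y d(1) by auto
    then have "f x \<in> ball (f z) (e / 2)" "f y \<in> ball (f z) (e / 2)" using z by blast+
    then have "dist (f z) (f x) < e / 2" "dist (f z) (f y) < e / 2" by simp_all
    then show ?thesis unfolding dist_real_def by linarith
  qed
  then show ?thesis using d(1) by blast
qed

text \<open>A continuous mapping and a Slutsky argument in one. Tightness is assumed of the limit
  only: weak convergence, tested with a continuous cutoff, keeps \<open>X n\<close> near a compact
  set with high probability, and on that bounded region the approximation is uniform.\<close>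

lemma converges_in_distribution_linear_approx:
  fixes X :: "nat \<Rightarrow> 'w \<Rightarrow> 'a::real_normed_vector" and Y :: "nat \<Rightarrow> 'w \<Rightarrow> 'b::real_normed_vector"
    and N :: "'v measure"
  assumes conv: "converges_in_distribution M X N Z"
    and M: "\<And>n. n \<ge> 1 \<Longrightarrow> prob_space (M n)" and N: "prob_space N"
    and tight: "tight_random_element N Z"
    and L: "bounded_linear L"
    and Y: "\<And>n. Y n \<in> borel_measurable (M n)"
    and approx: "\<And>r e. e > 0 \<Longrightarrow> \<exists>n0. \<forall>n\<ge>n0. \<forall>\<omega>\<in>space (M n).
      norm (X n \<omega>) \<le> r \<longrightarrow> norm (Y n \<omega> - L (X n \<omega>)) \<le> e"
  shows "converges_in_distribution M Y N (\<lambda>\<omega>. L (Z \<omega>))"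
  unfolding converges_in_distribution_def
proof (intro conjI allI impI)
  have X: "X n \<in> borel_measurable (M n)" for n using conv by (simp add: converges_in_distribution_def)
  have Z: "Z \<in> borel_measurable N" using conv by (simp add: converges_in_distribution_def)
  have X_lim: "(\<lambda>n. \<integral>\<omega>. g (X n \<omega>) \<partial>M n) \<longlonglongrightarrow> (\<integral>\<omega>. g (Z \<omega>) \<partial>N)"
    if "continuous_on UNIV g" "bounded (range g)" for g :: "'a \<Rightarrow> real"
    using conv that unfolding converges_in_distribution_def by blast
  have L_cont: "continuous_on UNIV L"
    using L by (simp add: linear_continuous_on)
  have L_meas: "L \<in> borel_measurable borel" using L_cont by (rule borel_measurable_continuous_onI)
  show "Y n \<in> borel_measurable (M n)" for n by (rule Y)
  show "(\<lambda>\<omega>. L (Z \<omega>)) \<in> borel_measurable N" using measurable_compose[OF Z L_meas] .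
  fix f :: "'b \<Rightarrow> real"
  assume "continuous_on UNIV f \<and> bounded (range f)"
  then have f: "continuous_on UNIV f" and "bounded (range f)" by auto
  then obtain B where B: "B > 0" "\<And>y. \<bar>f y\<bar> \<le> B" unfolding bounded_pos by auto
  have f_meas: "f \<in> borel_measurable borel" using f by (rule borel_measurable_continuous_onI)
  have fL: "continuous_on UNIV (\<lambda>x. f (L x))"
    using continuous_on_compose2[OF f L_cont] by simp
  have fL_lim: "(\<lambda>n. \<integral>\<omega>. f (L (X n \<omega>)) \<partial>M n) \<longlonglongrightarrow> (\<integral>\<omega>. f (L (Z \<omega>)) \<partial>N)"
    by (rule X_lim[OF fL]) (use B in \<open>auto simp: bounded_iff\<close>)
  have "(\<lambda>n. (\<integral>\<omega>. f (Y n \<omega>) \<partial>M n) - (\<integral>\<omega>. f (L (X n \<omega>)) \<partial>M n)) \<longlonglongrightarrow> 0"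
  proof (rule LIMSEQ_I)
    fix e :: real assume e: "e > 0"
    \<comment> \<open>The final estimate costs \<open>2 * \<epsilon>\<close> near the compact set
      and \<open>2 * B * (2 * \<epsilon>)\<close> for the mass away from it. The cap
      \<open>1 / 2\<close> makes the compact set nonempty.\<close>
    define \<epsilon> where "\<epsilon> = min (1 / 2) (e / (2 * (2 + 4 * B)))"
    have \<epsilon>: "\<epsilon> > 0" "\<epsilon> < 1" using e B(1) by (auto simp: \<epsilon>_def)
    have "\<epsilon> \<le> e / (2 * (2 + 4 * B))" by (simp add: \<epsilon>_def)
    then have "2 * (\<epsilon> * (2 + 4 * B)) \<le> e" using B(1) by (simp add: field_simps)
    moreover have "\<epsilon> * (2 + 4 * B) = 2 * \<epsilon> + 4 * B * \<epsilon>" by (simp add: algebra_simps)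
    ultimately have \<epsilon>_e: "2 * \<epsilon> + 4 * B * \<epsilon> < e" using e by linarith
    obtain K where K: "compact K" "measure N {\<omega> \<in> space N. Z \<omega> \<in> K} \<ge> 1 - \<epsilon>"
      using tight \<epsilon>(1) unfolding tight_random_element_def by blast
    have "K \<noteq> {}"
    proof
      assume "K = {}"
      then show False using K(2) \<epsilon>(2) by simp
    qed
    obtain d where d: "d > 0" "\<forall>x\<in>L ` K. \<forall>y. dist x y < d \<longrightarrow> \<bar>f x - f y\<bar> < \<epsilon>"
      using uniformly_near_compact[OF compact_continuous_image[OF continuous_on_subset[OF L_cont] K(1)] f \<epsilon>(1)]
      by auto
    obtain R where R: "R > 0" "\<And>x. norm (L x) \<le> norm x * R" using bounded_linear.pos_bounded[OF L] by blast
    \<comment> \<open>\<open>L\<close> maps the \<delta>-neighbourhood of \<open>K\<close> into the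
      \<open>d / 2\<close>-neighbourhood of its image, leaving room for an approximation error of
      \<open>d / 4\<close>.\<close>
    define \<delta> where "\<delta> = d / (2 * R)"
    have \<delta>: "\<delta> > 0" "\<delta> * R = d / 2" using d(1) R(1) by (auto simp: \<delta>_def)
    obtain r0 where r0: "\<And>x. x \<in> K \<Longrightarrow> norm x \<le> r0"
      using compact_imp_bounded[OF K(1)] unfolding bounded_iff by blast
    \<comment> \<open>A continuous minorant of the indicator of the \<open>\<delta>\<close>-neighbourhood of \<open>K\<close>, to which weak convergence
      applies.\<close>
    define h where "h x = max 0 (1 - infdist x K / \<delta>)" for x
    have h_cont: "continuous_on UNIV h"
      unfolding h_def using \<delta>(1) by (intro continuous_intros) auto
    have h01: "0 \<le> h x" "h x \<le> 1" for x
      using infdist_nonneg[of x K] \<delta>(1) by (auto simp: h_def)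
    have h_meas: "h \<in> borel_measurable borel" using h_cont by (rule borel_measurable_continuous_onI)
    have h_lim: "(\<lambda>n. \<integral>\<omega>. h (X n \<omega>) \<partial>M n) \<longlonglongrightarrow> (\<integral>\<omega>. h (Z \<omega>) \<partial>N)"
      by (rule X_lim[OF h_cont]) (use h01 in \<open>auto simp: bounded_iff intro!: exI[of _ 1]\<close>)
    interpret N: prob_space N by (rule N)
    have Z_K: "{\<omega> \<in> space N. Z \<omega> \<in> K} \<in> sets N"
      using measurable_sets[OF Z borel_compact[OF K(1)]] by (simp add: vimage_def Int_def conj_commute)
    have "1 - \<epsilon> \<le> (\<integral>\<omega>. indicator {\<omega> \<in> space N. Z \<omega> \<in> K} \<omega> \<partial>N)"
      using K(2) Z_K by simp
    also have "\<dots> \<le> (\<integral>\<omega>. h (Z \<omega>) \<partial>N)"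
    proof (rule integral_mono)
      show "integrable N (\<lambda>\<omega>. indicator {\<omega> \<in> space N. Z \<omega> \<in> K} \<omega> :: real)"
        using Z_K by (simp add: N.emeasure_eq_measure)
      show "integrable N (\<lambda>\<omega>. h (Z \<omega>))"
        using measurable_compose[OF Z h_meas] h01 by (intro N.integrable_const_bound[where B=1]) auto
      show "indicator {\<omega> \<in> space N. Z \<omega> \<in> K} \<omega> \<le> h (Z \<omega>)" for \<omega>
        using h01 by (auto simp: indicator_def h_def)
    qed
    finally have "(\<integral>\<omega>. h (Z \<omega>) \<partial>N) > 1 - 2 * \<epsilon>" using \<epsilon>(1) by linarith
    then have "\<forall>\<^sub>F n in sequentially. (\<integral>\<omega>. h (X n \<omega>) \<partial>M n) > 1 - 2 * \<epsilon>"
      using order_tendstoD(1)[OF h_lim] by blast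
    then obtain n1 where n1: "\<And>n. n \<ge> n1 \<Longrightarrow> (\<integral>\<omega>. h (X n \<omega>) \<partial>M n) > 1 - 2 * \<epsilon>"
      unfolding eventually_sequentially by blast
    have "d / 4 > 0" using d(1) by simp
    from approx[OF this, of "r0 + \<delta>"] obtain n2 where n2: "\<forall>n\<ge>n2. \<forall>\<omega>\<in>space (M n).
        norm (X n \<omega>) \<le> r0 + \<delta> \<longrightarrow> norm (Y n \<omega> - L (X n \<omega>)) \<le> d / 4"
      by (elim exE)
    \<comment> \<open>Where \<open>h\<close> vanishes, the trivial bound \<open>2 * B\<close>
      applies. Elsewhere \<open>X n \<omega>\<close> is close to some \<open>x\<close> in
      \<open>K\<close>, and both values of \<open>f\<close> lie within \<epsilon> of
      \<open>f (L x)\<close>.\<close>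
    have pointwise: "\<bar>f (Y n \<omega>) - f (L (X n \<omega>))\<bar> \<le> 2 * \<epsilon> + 2 * B * (1 - h (X n \<omega>))"
      if n: "n \<ge> n2" and \<omega>: "\<omega> \<in> space (M n)" for n \<omega>
    proof (cases "h (X n \<omega>) = 0")
      case True
      then show ?thesis using B(2)[of "Y n \<omega>"] B(2)[of "L (X n \<omega>)"] \<epsilon>(1) by simp
    next
      case False
      have "infdist (X n \<omega>) K / \<delta> < 1"
      proof (rule ccontr)
        assume "\<not> ?thesis"
        then have "1 - infdist (X n \<omega>) K / \<delta> \<le> 0" by linarith
        then show False using False unfolding h_def by (simp add: max.absorb1)
      qed
      then have "infdist (X n \<omega>) K < \<delta>" using \<delta>(1) by (simp add: field_simps)
      then obtain x where x: "x \<in> K" "dist (X n \<omega>) x < \<delta>"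
        using \<open>K \<noteq> {}\<close> by (auto simp: infdist_def cINF_less_iff)
      have "norm (X n \<omega>) \<le> norm x + dist (X n \<omega>) x"
        using norm_triangle_sub[of "X n \<omega>" x] by (simp add: dist_norm)
      then have "norm (X n \<omega>) \<le> r0 + \<delta>" using x r0[OF x(1)] by linarith
      then have Yd: "dist (Y n \<omega>) (L (X n \<omega>)) \<le> d / 4" using n2 n \<omega> by (simp add: dist_norm)
      have "dist (L x) (L (X n \<omega>)) \<le> norm (x - X n \<omega>) * R"
        using R(2)[of "x - X n \<omega>"] linear_diff[OF bounded_linear.linear[OF L], of x "X n \<omega>"]
        by (simp add: dist_norm)
      also have "\<dots> \<le> \<delta> * R"
        using x(2) R(1) by (intro mult_right_mono) (simp_all add: dist_norm norm_minus_commute)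
      finally have Ld: "dist (L x) (L (X n \<omega>)) \<le> d / 2" using \<delta>(2) by simp
      have "\<bar>f (L x) - f (L (X n \<omega>))\<bar> < \<epsilon>" using d x(1) Ld by auto
      moreover have "dist (L x) (Y n \<omega>) < d"
        using dist_triangle[of "L x" "Y n \<omega>" "L (X n \<omega>)"] Ld Yd d(1) by (simp add: dist_commute)
      then have "\<bar>f (L x) - f (Y n \<omega>)\<bar> < \<epsilon>" using d(2) x(1) by blast
      ultimately have "\<bar>f (Y n \<omega>) - f (L (X n \<omega>))\<bar> \<le> 2 * \<epsilon>" by linarith
      moreover have "0 \<le> 2 * B * (1 - h (X n \<omega>))" using B(1) h01 by simp
      ultimately show ?thesis by linarith
    qed
    have "norm ((\<integral>\<omega>. f (Y n \<omega>) \<partial>M n) - (\<integral>\<omega>. f (L (X n \<omega>)) \<partial>M n) - 0) < e"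
      if n: "n \<ge> max 1 (max n1 n2)" for n
    proof -
      interpret Mn: prob_space "M n" using M n by simp
      have int_f: "integrable (M n) (\<lambda>\<omega>. f (V \<omega>))" if "V \<in> borel_measurable (M n)" for V
        using measurable_compose[OF that f_meas] B(2)
        by (intro Mn.integrable_const_bound[where B=B]) auto
      have int_Y: "integrable (M n) (\<lambda>\<omega>. f (Y n \<omega>))" by (rule int_f[OF Y])
      have int_X: "integrable (M n) (\<lambda>\<omega>. f (L (X n \<omega>)))"
        by (rule int_f[OF measurable_compose[OF X L_meas]])
      have int_h: "integrable (M n) (\<lambda>\<omega>. h (X n \<omega>))"
        using measurable_compose[OF X h_meas] h01 by (intro Mn.integrable_const_bound[where B=1]) auto
      have "\<bar>(\<integral>\<omega>. f (Y n \<omega>) \<partial>M n) - (\<integral>\<omega>. f (L (X n \<omega>)) \<partial>M n)\<bar>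
          = \<bar>\<integral>\<omega>. f (Y n \<omega>) - f (L (X n \<omega>)) \<partial>M n\<bar>"
        using int_Y int_X by simp
      also have "\<dots> \<le> (\<integral>\<omega>. \<bar>f (Y n \<omega>) - f (L (X n \<omega>))\<bar> \<partial>M n)"
        by (rule integral_abs_bound)
      also have "\<dots> \<le> (\<integral>\<omega>. 2 * \<epsilon> + 2 * B * (1 - h (X n \<omega>)) \<partial>M n)"
        using int_Y int_X int_h pointwise n by (intro integral_mono) auto
      also have "\<dots> = 2 * \<epsilon> + 2 * B * (1 - (\<integral>\<omega>. h (X n \<omega>) \<partial>M n))"
        using int_h by (simp add: Mn.prob_space)
      also have "\<dots> \<le> 2 * \<epsilon> + 2 * B * (2 * \<epsilon>)"
        using n1[of n] n B(1) by (intro add_left_mono mult_left_mono) auto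
      also have "\<dots> < e" using \<epsilon>_e by simp
      finally show ?thesis by simp
    qed
    then show "\<exists>n0. \<forall>n\<ge>n0. norm ((\<integral>\<omega>. f (Y n \<omega>) \<partial>M n) - (\<integral>\<omega>. f (L (X n \<omega>)) \<partial>M n) - 0) < e"
      by blast
  qed
  from tendsto_add[OF this fL_lim]
  show "(\<lambda>n. \<integral>\<omega>. f (Y n \<omega>) \<partial>M n) \<longlonglongrightarrow> (\<integral>\<omega>. f (L (Z \<omega>)) \<partial>N)" by simp
qed

theorem theorem3:
  fixes \<Gamma> :: kernel
    and J :: "int set"
    and lam :: "int \<Rightarrow> real"
    and \<phi> :: "int \<Rightarrow> unit_ivl \<Rightarrow> real"
    and M :: "nat \<Rightarrow> 'w measure"
    and \<Gamma>_hat :: "nat \<Rightarrow> 'w \<Rightarrow> kernel"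
    and N :: "'v measure"
    and \<G> :: "'v \<Rightarrow> kernel"
    and k :: nat
    and \<phi>_hat :: "nat \<Rightarrow> 'w \<Rightarrow> (unit_ivl \<Rightarrow>\<^sub>C real)"
  assumes "covariance_kernel \<Gamma>"
    and "eigenbasis \<Gamma> J lam \<phi>"
    and "\<And>n. n \<ge> 1 \<Longrightarrow> prob_space (M n)"
    and "\<And>n. n \<ge> 1 \<Longrightarrow> \<Gamma>_hat n \<in> borel_measurable (M n)"
    and "\<And>n \<omega>. n \<ge> 1 \<Longrightarrow> \<omega> \<in> space (M n) \<Longrightarrow> symmetric_kernel (\<Gamma>_hat n \<omega>)"
    and "prob_space N"
    and "tight_random_element N \<G>"
    and "converges_in_distribution M (\<lambda>n \<omega>. sqrt (real n) *\<^sub>R (\<Gamma>_hat n \<omega> - \<Gamma>)) N \<G>"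
    and "k \<ge> 1"
    and "lam (int k) > 0"
    and "multiplicity_of \<Gamma> (lam (int k)) = 1"
    and "\<And>n. n \<ge> 1 \<Longrightarrow> \<phi>_hat n \<in> borel_measurable (M n)"
    and "\<And>n \<omega>. n \<ge> 1 \<Longrightarrow> \<omega> \<in> space (M n) \<Longrightarrow> kth_eigenvalue (\<Gamma>_hat n \<omega>) k > 0 \<Longrightarrow>
           \<phi>_hat n \<omega> \<in> eigenspace (\<Gamma>_hat n \<omega>) (kth_eigenvalue (\<Gamma>_hat n \<omega>) k) \<and>
           L2_norm (apply_bcontfun (\<phi>_hat n \<omega>)) = 1 \<and>
           L2_inner (apply_bcontfun (\<phi>_hat n \<omega>)) (\<phi> (int k)) \<ge> 0"
  shows "\<exists>Z :: 'v \<Rightarrow> (unit_ivl \<Rightarrow>\<^sub>C real).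
           (\<forall>\<omega>\<in>space N.
              has_L2_sum
                (\<lambda>j x. L2_inner (int_op (\<G> \<omega>) (\<phi> (int k))) (\<phi> j) / (lam (int k) - lam j) * \<phi> j x)
                (J - {int k}) (apply_bcontfun (Z \<omega>))) \<and>
           converges_in_distribution M
             (\<lambda>n \<omega>. sqrt (real n) *\<^sub>R (\<phi>_hat n \<omega> - Bcontfun (\<phi> (int k)))) N Z"
proof -
  interpret simple_eigenvalue \<Gamma> J lam \<phi> k
    using assms(1,2,9-11) by unfold_locales (simp_all add: covariance_kernel_def)
  let ?X = "\<lambda>n \<omega>. sqrt (real n) *\<^sub>R (\<Gamma>_hat n \<omega> - \<Gamma>)"
  let ?Y = "\<lambda>n \<omega>. sqrt (real n) *\<^sub>R (\<phi>_hat n \<omega> - Bcontfun (\<phi> (int k)))"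
  \<comment> \<open>The derivative of the eigenfunction with respect to the kernel at \<Gamma>;
    composed with the limiting kernel it is the witness \<open>Z\<close>.\<close>
  define L where "L G = resolvent (kernel_op G (\<phi> (int k)))" for G
  have \<phi>_k: "\<phi> (int k) \<in> L2" by (rule \<phi>_L2[OF k_in_J])
  have L: "bounded_linear L"
    using bounded_linear_compose[OF bounded_linear_resolvent bounded_linear_kernel_op_kernel[OF \<phi>_k]]
    by (simp add: L_def[abs_def])
  have "has_L2_sum
      (\<lambda>j x. L2_inner (int_op (\<G> \<omega>) (\<phi> (int k))) (\<phi> j) / (lam (int k) - lam j) * \<phi> j x)
      (J - {int k}) (apply_bcontfun (L (\<G> \<omega>)))" for \<omega>
  proof -
    have "apply_bcontfun (kernel_op (\<G> \<omega>) (\<phi> (int k))) = int_op (\<G> \<omega>) (\<phi> (int k))"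
      using apply_kernel_op[OF \<phi>_k] by blast
    then show ?thesis
      using has_L2_sum_resolvent[of "kernel_op (\<G> \<omega>) (\<phi> (int k))"] by (simp add: L_def)
  qed
  moreover have "converges_in_distribution M ?Y N (\<lambda>\<omega>. L (\<G> \<omega>))"
  proof (rule converges_in_distribution_linear_approx[OF assms(8,3,6,7) L])
    \<comment> \<open>At \<open>n = 0\<close> no measurability of the eigenfunction is assumed, but
      the factor \<open>sqrt 0\<close> makes \<open>?Y 0\<close> constant.\<close>
    show "?Y n \<in> borel_measurable (M n)" for n
    proof (cases "n = 0")
      case False
      have "(\<lambda>g. sqrt (real n) *\<^sub>R (g - Bcontfun (\<phi> (int k)))) \<in> borel_measurable borel"
        by (intro borel_measurable_continuous_onI continuous_intros)
      then show ?thesis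
        using measurable_compose[OF assms(12)[of n]] False by simp
    qed simp
    fix r e :: real assume e: "e > 0"
    from eigenfunction_expansion obtain C where C: "C \<ge> 0"
      and expansion: "\<forall>G f. symmetric_kernel G \<longrightarrow> norm (G - \<Gamma>) < lam (int k) / 2 \<longrightarrow>
        f \<in> eigenspace G (kth_eigenvalue G k) \<longrightarrow> L2_norm (apply_bcontfun f) = 1 \<longrightarrow>
        0 \<le> L2_inner (apply_bcontfun f) (\<phi> (int k)) \<longrightarrow>
        norm (f - \<psi> (int k) - resolvent (kernel_op (G - \<Gamma>) (\<phi> (int k)))) \<le> C * (norm (G - \<Gamma>))\<^sup>2"
      by (elim exE conjE)
    have lim: "(\<lambda>n. c / sqrt (real n)) \<longlonglongrightarrow> 0" for c
      by real_asymp
    \<comment> \<open>On the ball of radius \<open>r\<close> the unscaled perturbation has norm at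
      most \<open>r / sqrt n\<close>. The expansion then applies for large \<open>n\<close>, and its
      quadratic error, multiplied by \<open>sqrt n\<close>, is at most
      \<open>C * r\<^sup>2 / sqrt n\<close>.\<close>
    have "\<forall>\<^sub>F n in sequentially. r / sqrt (real n) < lam (int k) / 2"
      using order_tendstoD(2)[OF lim, of "lam (int k) / 2"] lam_pos by simp
    moreover have "\<forall>\<^sub>F n in sequentially. C * r\<^sup>2 / sqrt (real n) < e"
      using order_tendstoD(2)[OF lim, of e] e by simp
    ultimately have "\<forall>\<^sub>F n in sequentially. n \<ge> 1 \<and> r / sqrt (real n) < lam (int k) / 2 \<and> C * r\<^sup>2 / sqrt (real n) < e"
      using eventually_ge_at_top[of 1] by eventually_elim auto
    then obtain n0 where n0: "\<And>n. n \<ge> n0 \<Longrightarrow>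
        n \<ge> 1 \<and> r / sqrt (real n) < lam (int k) / 2 \<and> C * r\<^sup>2 / sqrt (real n) < e"
      unfolding eventually_sequentially by blast
    have "norm (?Y n \<omega> - L (?X n \<omega>)) \<le> e"
      if n: "n \<ge> n0" and \<omega>: "\<omega> \<in> space (M n)" and r: "norm (?X n \<omega>) \<le> r" for n \<omega>
    proof -
      define s where "s = sqrt (real n)"
      define d where "d = norm (\<Gamma>_hat n \<omega> - \<Gamma>)"
      have n1: "n \<ge> 1" and small: "r / s < lam (int k) / 2" "C * r\<^sup>2 / s < e"
        using n0[OF n] by (auto simp: s_def)
      have s: "s > 0" using n1 by (simp add: s_def)
      have "s * d \<le> r" using r by (simp only: norm_scaleR s_def d_def) simp
      then have d_le: "d \<le> r / s" using s by (simp add: pos_le_divide_eq mult.commute)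
      then have d: "d < lam (int k) / 2" using small by linarith
      have sym_hat: "symmetric_kernel (\<Gamma>_hat n \<omega>)" using assms(5)[OF n1 \<omega>] .
      \<comment> \<open>Outside this event nothing is known about the chosen eigenfunction; the
        perturbation bound shows that the ball lies inside it.\<close>
      have "kth_eigenvalue (\<Gamma>_hat n \<omega>) k > 0"
        using kth_eigenvalue_perturbation[OF sym_hat] d lam_pos unfolding d_def by linarith
      from assms(13)[OF n1 \<omega> this]
      have main: "norm (\<phi>_hat n \<omega> - \<psi> (int k) - L (\<Gamma>_hat n \<omega> - \<Gamma>)) \<le> C * d\<^sup>2"
        unfolding L_def d_def using expansion sym_hat d[unfolded d_def] by blast
      have "?Y n \<omega> - L (?X n \<omega>) = s *\<^sub>R (\<phi>_hat n \<omega> - \<psi> (int k) - L (\<Gamma>_hat n \<omega> - \<Gamma>))"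
        unfolding linear_scale[OF bounded_linear.linear[OF L]]
        by (simp add: s_def \<psi>_def scaleR_diff_right)
      then have "norm (?Y n \<omega> - L (?X n \<omega>)) = s * norm (\<phi>_hat n \<omega> - \<psi> (int k) - L (\<Gamma>_hat n \<omega> - \<Gamma>))"
        using s by simp
      also have "\<dots> \<le> s * (C * d\<^sup>2)" using main s by (intro mult_left_mono) auto
      also have "\<dots> \<le> s * (C * (r / s)\<^sup>2)"
        using s C d_le by (intro mult_left_mono power_mono) (auto simp: d_def)
      also have "\<dots> = C * r\<^sup>2 / s" using s by (simp add: field_simps power2_eq_square)
      finally show ?thesis using small by linarith
    qed
    then show "\<exists>n0. \<forall>n\<ge>n0. \<forall>\<omega>\<in>space (M n). norm (?X n \<omega>) \<le> r \<longrightarrow> norm (?Y n \<omega> - L (?X n \<omega>)) \<le> e"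
      by blast
  qed
  ultimately show ?thesis
    by (intro exI[of _ "\<lambda>\<omega>. L (\<G> \<omega>)"] conjI ballI)
qed

end
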